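(* Let $L$ be the group of unit lower triangular real $n\times n$ matrices, let $\sigma$ be any $n\times n$ permutation matrix, and let $L(\sigma)=L\cap\sigma L\sigma^{-1}$, i.e. the subgroup of those $\ell\in L$ for which $\sigma^{-1}\ell\sigma$ is lower triangular. Then the following properties hold. (i) The subgroup $L(\sigma)$ is the intersection of $L$ with a certain coordinate subspace of the vector space of square matrices (i.e. it is obtained by setting certain entries of $L$ equal to zero). (ii) The (not everywhere defined) map $\Phi(\sigma):L\dashrightarrow L$ is defined on $L(\sigma^{-1})$, and its restriction to $L(\sigma^{-1})$ defines a real analytic diffeomorphism $$\Phi(\sigma):L(\sigma^{-1})\to L(\sigma).$$
   Context: Definition of $\Phi(\sigma)$: given $\ell\in L$, let $q\in\mathrm{SO}(n,\mathbb{R})$ be its orthogonal factor in the Gram-Schmidt factorization $\ell=qr$, with $r$ upper triangular with strictly positive diagonal entries. Conjugate $q$ by the permutation matrix to get $\sigma q\sigma^{-1}\in\mathrm{SO}(n,\mathbb{R})$. If $\sigma q\sigma^{-1}$ admits a $UL$ factorization, i.e. $\sigma q\sigma^{-1}=u\,\ell'$ with $u$ upper triangular (invertible) and $\ell'\in L$ (such a factorization is unique when it exists), then $\Phi(\sigma)(\ell):=\ell'$; otherwise $\Phi(\sigma)$ is not defined at $\ell$. *)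

theory Defs
  imports "HOL-Analysis.Analysis" "HOL-Algebra.Group"
begin

text \<open>
  A multi-index is a function \<open>\<alpha> :: 'a \<Rightarrow> nat\<close> on the orthonormal basis \<open>Basis\<close>; requiring
  it to vanish off the basis makes the representation unique.
\<close>

definition multi_indices :: "('a::euclidean_space \<Rightarrow> nat) set" where
  "multi_indices = {\<alpha>. \<forall>b. b \<notin> Basis \<longrightarrow> \<alpha> b = 0}"

definition multi_power :: "'a::euclidean_space \<Rightarrow> ('a \<Rightarrow> nat) \<Rightarrow> real" where
  "multi_power x \<alpha> = (\<Prod>b\<in>Basis. (x \<bullet> b) ^ \<alpha> b)"

text \<open>
  As usual for a map on a subset \<open>S\<close> (such as an affine subspace) of a Euclidean space, analyticity
  means that near each point of \<open>S\<close> the map agrees on \<open>S\<close> with the sum of a power series that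
  converges on a full neighbourhood of the point in the ambient space. If \<open>S\<close> is an affine
  subspace, this is the same as analyticity in affine coordinates on \<open>S\<close>.
\<close>

definition real_analytic_on ::
    "('a::euclidean_space \<Rightarrow> 'b::euclidean_space) \<Rightarrow> 'a set \<Rightarrow> bool" where
  "real_analytic_on f S \<longleftrightarrow>
     (\<forall>a\<in>S. \<exists>r>0. \<exists>c :: ('a \<Rightarrow> nat) \<Rightarrow> 'b.
        (\<forall>x\<in>ball a r. (\<lambda>\<alpha>. multi_power (x - a) \<alpha> *\<^sub>R c \<alpha>) summable_on multi_indices) \<and>
        (\<forall>x\<in>S \<inter> ball a r.
           ((\<lambda>\<alpha>. multi_power (x - a) \<alpha> *\<^sub>R c \<alpha>) has_sum f x) multi_indices))"

definition real_analytic_diffeomorphism ::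
    "('a::euclidean_space \<Rightarrow> 'b::euclidean_space) \<Rightarrow> 'a set \<Rightarrow> 'b set \<Rightarrow> bool" where
  "real_analytic_diffeomorphism f S T \<longleftrightarrow>
     bij_betw f S T \<and> real_analytic_on f S \<and> real_analytic_on (inv_into S f) T"

definition lower_triangular :: "real^'n::{finite,wellorder}^'n::{finite,wellorder} \<Rightarrow> bool" where
  "lower_triangular A \<longleftrightarrow> (\<forall>i j. i < j \<longrightarrow> A $ i $ j = 0)"

definition upper_triangular :: "real^'n::{finite,wellorder}^'n::{finite,wellorder} \<Rightarrow> bool" where
  "upper_triangular A \<longleftrightarrow> (\<forall>i j. j < i \<longrightarrow> A $ i $ j = 0)"

definition unit_lower :: "(real^'n::{finite,wellorder}^'n::{finite,wellorder}) set" where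
  "unit_lower = {A. lower_triangular A \<and> (\<forall>i. A $ i $ i = 1)}"

definition unit_lower_group :: "(real^'n::{finite,wellorder}^'n::{finite,wellorder}) monoid" where
  "unit_lower_group = \<lparr>carrier = unit_lower, mult = (**), one = mat 1\<rparr>"

definition permutation_matrix :: "real^'n^'n \<Rightarrow> bool" where
  "permutation_matrix \<sigma> \<longleftrightarrow> (\<exists>p. bij p \<and> \<sigma> = (\<chi> i j. if i = p j then 1 else 0))"

definition unit_lower_sub ::
    "real^'n::{finite,wellorder}^'n::{finite,wellorder} \<Rightarrow> (real^'n::{finite,wellorder}^'n::{finite,wellorder}) set" where
  "unit_lower_sub \<sigma> = unit_lower \<inter> (\<lambda>A. \<sigma> ** A ** matrix_inv \<sigma>) ` unit_lower"

definition gram_schmidt_factor ::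
    "real^'n::{finite,wellorder}^'n::{finite,wellorder} \<Rightarrow> real^'n::{finite,wellorder}^'n::{finite,wellorder}" where
  "gram_schmidt_factor l =
     (THE q. rotation_matrix q \<and>
        (\<exists>r. upper_triangular r \<and> (\<forall>i. r $ i $ i > 0) \<and> l = q ** r))"

definition is_UL_factorization ::
    "real^'n::{finite,wellorder}^'n::{finite,wellorder} \<Rightarrow> real^'n::{finite,wellorder}^'n::{finite,wellorder} \<Rightarrow>
     real^'n::{finite,wellorder}^'n::{finite,wellorder} \<Rightarrow> bool" where
  "is_UL_factorization A u l \<longleftrightarrow>
     upper_triangular u \<and> invertible u \<and> l \<in> unit_lower \<and> A = u ** l"

definition Phi ::
    "real^'n::{finite,wellorder}^'n::{finite,wellorder} \<Rightarrow>
     (real^'n::{finite,wellorder}^'n::{finite,wellorder} \<rightharpoonup> real^'n::{finite,wellorder}^'n::{finite,wellorder})" where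
  "Phi \<sigma> l =
     (let A = \<sigma> ** gram_schmidt_factor l ** matrix_inv \<sigma>
      in if l \<in> unit_lower \<and> (\<exists>u l'. is_UL_factorization A u l')
         then Some (THE l'. \<exists>u. is_UL_factorization A u l')
         else None)"

lemma unit_lower_mult:
  fixes A B :: "real^'n::{finite,wellorder}^'n::{finite,wellorder}"
  assumes "A \<in> unit_lower" "B \<in> unit_lower"
  shows "A ** B \<in> unit_lower"
proof -
  have A: "A $ i $ j = 0" if "i < j" for i j
    using assms(1) that by (simp add: unit_lower_def lower_triangular_def)
  have B: "B $ i $ j = 0" if "i < j" for i j
    using assms(2) that by (simp add: unit_lower_def lower_triangular_def)
  have "(A ** B) $ i $ j = 0" if "i < j" for i j
  proof -
    have "A $ i $ k * B $ k $ j = 0" for k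
      using A[of i k] B[of k j] that by (cases "i < k") auto
    then have "(\<Sum>k\<in>UNIV. A $ i $ k * B $ k $ j) = 0"
      by (intro sum.neutral) blast
    then show ?thesis
      by (simp add: matrix_matrix_mult_def)
  qed
  moreover have "(A ** B) $ i $ i = 1" for i
  proof -
    have "A $ i $ k * B $ k $ i = (if k = i then 1 else 0)" for k
      using A[of i k] B[of k i] assms by (cases k i rule: linorder_cases) (auto simp: unit_lower_def)
    then show ?thesis
      by (simp add: matrix_matrix_mult_def)
  qed
  ultimately show ?thesis
    by (simp add: unit_lower_def lower_triangular_def)
qed

lemma unit_lower_one: "(mat 1 :: real^'n::{finite,wellorder}^'n::{finite,wellorder}) \<in> unit_lower"
  by (auto simp: unit_lower_def lower_triangular_def mat_def)

lemma unit_lower_inverse: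
  fixes A :: "real^'n::{finite,wellorder}^'n::{finite,wellorder}"
  assumes "A \<in> unit_lower"
  obtains B where "B \<in> unit_lower" "B ** A = mat 1" "A ** B = mat 1"
proof -
  have A: "A $ i $ j = 0" if "i < j" for i j
    using assms that by (simp add: unit_lower_def lower_triangular_def)
  have A1: "A $ i $ i = 1" for i
    using assms by (simp add: unit_lower_def)
  have "det A = 1"
    using det_lowerdiagonal[of A] A A1 by simp
  then obtain B where B: "A ** B = mat 1" "B ** A = mat 1"
    using invertible_det_nz[of A] unfolding invertible_def by auto
  have step: "B $ i $ j = (if i = j then 1 else 0)" if "i \<le> j" for i j
    using that
  proof (induction i rule: less_induct)
    case (less i)
    have "A $ i $ k * B $ k $ j = (if k = i then B $ i $ j else 0)" for k
      using less A[of i k] A1 by (cases k i rule: linorder_cases) auto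
    then have "(A ** B) $ i $ j = B $ i $ j"
      by (simp add: matrix_matrix_mult_def)
    then show ?case
      using B by (simp add: mat_def)
  qed
  then have "B \<in> unit_lower"
    by (auto simp: unit_lower_def lower_triangular_def)
  with B that show thesis by blast
qed

lemma group_unit_lower_group:
  "group (unit_lower_group :: (real^'n::{finite,wellorder}^'n::{finite,wellorder}) monoid)"
proof (rule groupI)
  fix x :: "real^'n::{finite,wellorder}^'n::{finite,wellorder}"
  assume "x \<in> carrier unit_lower_group"
  then show "\<exists>y\<in>carrier unit_lower_group. y \<otimes>\<^bsub>unit_lower_group\<^esub> x = \<one>\<^bsub>unit_lower_group\<^esub>"
    using unit_lower_inverse[of x] by (auto simp: unit_lower_group_def)
qed (auto simp: unit_lower_group_def unit_lower_mult unit_lower_one matrix_mul_assoc)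

lemma permutation_matrix_inverse:
  fixes \<sigma> :: "real^'n^'n"
  assumes "permutation_matrix \<sigma>"
  shows "matrix_inv \<sigma> = transpose \<sigma>"
    and "\<sigma> ** matrix_inv \<sigma> = mat 1" and "matrix_inv \<sigma> ** \<sigma> = mat 1"
proof -
  obtain p where p: "bij p" "\<sigma> = (\<chi> i j. if i = p j then 1 else 0)"
    using assms by (auto simp: permutation_matrix_def)
  have "(transpose \<sigma> ** \<sigma>) $ i $ j = mat 1 $ i $ j" for i j
  proof -
    have *: "(if k = p i then 1 else 0) * (if k = p j then 1 else 0) =
        (if k = p i then if i = j then 1 else 0 else (0::real))" for k
      using p(1) by (auto simp: bij_def inj_def)
    show ?thesis
      by (simp add: p(2) matrix_matrix_mult_def transpose_def mat_def *)
  qed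
  then have 1: "transpose \<sigma> ** \<sigma> = mat 1"
    by (simp add: vec_eq_iff)
  then have 2: "\<sigma> ** transpose \<sigma> = mat 1"
    by (simp add: matrix_left_right_inverse)
  have inv: "\<sigma> ** matrix_inv \<sigma> = mat 1 \<and> matrix_inv \<sigma> ** \<sigma> = mat 1"
    unfolding matrix_inv_def by (rule someI[of _ "transpose \<sigma>"]) (use 1 2 in simp)
  then show "\<sigma> ** matrix_inv \<sigma> = mat 1" "matrix_inv \<sigma> ** \<sigma> = mat 1"
    by auto
  show "matrix_inv \<sigma> = transpose \<sigma>"
    by (metis 1 inv matrix_mul_assoc matrix_mul_lid matrix_mul_rid)
qed

lemma unit_lower_sub_altdef:
  fixes \<sigma> :: "real^'n::{finite,wellorder}^'n::{finite,wellorder}"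
  assumes "permutation_matrix \<sigma>"
  shows "unit_lower_sub \<sigma> = {l \<in> unit_lower. lower_triangular (matrix_inv \<sigma> ** l ** \<sigma>)}"
proof -
  note \<sigma> = permutation_matrix_inverse[OF assms]
  obtain p where p: "bij p" "\<sigma> = (\<chi> i j. if i = p j then 1 else 0)"
    using assms by (auto simp: permutation_matrix_def)
  have conj: "(matrix_inv \<sigma> ** l ** \<sigma>) $ i $ j = l $ p i $ p j" for l i j
    unfolding \<sigma>(1)
    by (simp add: p(2) matrix_matrix_mult_def transpose_def mult_delta_left mult_delta_right)
  have 1: "matrix_inv \<sigma> ** (\<sigma> ** A ** matrix_inv \<sigma>) ** \<sigma> = A" for A
  proof -
    have "matrix_inv \<sigma> ** (\<sigma> ** A ** matrix_inv \<sigma>) ** \<sigma>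
        = (matrix_inv \<sigma> ** \<sigma>) ** A ** (matrix_inv \<sigma> ** \<sigma>)"
      by (simp only: matrix_mul_assoc)
    then show ?thesis
      by (simp add: \<sigma>(3))
  qed
  have 2: "\<sigma> ** (matrix_inv \<sigma> ** A ** \<sigma>) ** matrix_inv \<sigma> = A" for A
  proof -
    have "\<sigma> ** (matrix_inv \<sigma> ** A ** \<sigma>) ** matrix_inv \<sigma>
        = (\<sigma> ** matrix_inv \<sigma>) ** A ** (\<sigma> ** matrix_inv \<sigma>)"
      by (simp only: matrix_mul_assoc)
    then show ?thesis
      by (simp add: \<sigma>(2))
  qed
  have "l \<in> (\<lambda>A. \<sigma> ** A ** matrix_inv \<sigma>) ` unit_lower \<longleftrightarrow> lower_triangular (matrix_inv \<sigma> ** l ** \<sigma>)"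
    if "l \<in> unit_lower" for l
  proof
    assume "l \<in> (\<lambda>A. \<sigma> ** A ** matrix_inv \<sigma>) ` unit_lower"
    then show "lower_triangular (matrix_inv \<sigma> ** l ** \<sigma>)"
      by (auto simp: 1 unit_lower_def)
  next
    assume "lower_triangular (matrix_inv \<sigma> ** l ** \<sigma>)"
    then have "matrix_inv \<sigma> ** l ** \<sigma> \<in> unit_lower"
      using that by (simp add: unit_lower_def conj)
    then show "l \<in> (\<lambda>A. \<sigma> ** A ** matrix_inv \<sigma>) ` unit_lower"
      using 2[of l] by (metis imageI)
  qed
  then show ?thesis
    by (auto simp: unit_lower_sub_def)
qed

end

theory Submission
  imports Defs
begin

text \<open>
  Let \<open>l = q r\<close> be the Gram-Schmidt factorization of \<open>l \<in> L(\<sigma>\<^sup>-\<^sup>1)\<close>. As \<open>q\<close> is orthogonal, also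
  \<open>q = m\<^sup>T r\<^sup>T\<close> with \<open>m = l\<^sup>-\<^sup>1\<close>. The conjugate of \<open>m\<^sup>T\<close> by \<open>\<sigma>\<close> is still upper triangular, and
  \<open>r\<^sup>T = n1 d n2\<close>, where \<open>d\<close> is diagonal and \<open>n1\<close>, \<open>n2\<close> are unit lower triangular with off-diagonal
  entries only at the inversions and noninversions of the permutation; hence \<open>\<sigma> n1 d \<sigma>\<^sup>-\<^sup>1\<close> is
  upper and \<open>\<sigma> n2 \<sigma>\<^sup>-\<^sup>1\<close> is lower triangular, and \<open>\<Phi>(\<sigma>)(l) = \<sigma> n2 \<sigma>\<^sup>-\<^sup>1\<close>. The entries of \<open>n2\<close> are
  obtained from those of \<open>l\<close> by ring operations and by inverses and square roots of positive
  quantities, so they are analytic. Transposing both factorizations gives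
  \<open>\<Phi>(\<sigma>\<^sup>-\<^sup>1)(\<Phi>(\<sigma>)(l)\<^sup>-\<^sup>1) = l\<^sup>-\<^sup>1\<close>, so the inverse of \<open>\<Phi>(\<sigma>)\<close> is \<open>\<Phi>(\<sigma>\<^sup>-\<^sup>1)\<close> conjugated by matrix
  inversion.
\<close>

text \<open>The index set is in bijection with the disjoint union of the fibres of
  \<open>\<phi>\<close>, so the sum may be taken fibre by fibre; each fibre sum converges because
  the reals are complete. This serves to collect terms of equal multi-index.\<close>

lemma has_sum_fibres:
  fixes f :: "'i \<Rightarrow> real"
  assumes "f summable_on I" "\<phi> ` I \<subseteq> M"
  shows "((\<lambda>\<beta>. infsum f {i\<in>I. \<phi> i = \<beta>}) has_sum infsum f I) M"
proof -
  have img: "(\<lambda>i. (\<phi> i, i)) ` I = Sigma M (\<lambda>\<beta>. {i\<in>I. \<phi> i = \<beta>})"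
    using assms(2) by auto
  have "((f \<circ> snd) has_sum infsum f I) ((\<lambda>i. (\<phi> i, i)) ` I)"
    using assms(1) by (subst has_sum_reindex) (auto simp: inj_on_def o_def)
  then have "((\<lambda>(\<beta>, i). f i) has_sum infsum f I) (Sigma M (\<lambda>\<beta>. {i\<in>I. \<phi> i = \<beta>}))"
    unfolding img by (simp add: o_def case_prod_beta')
  then show ?thesis
  proof (rule has_sum_SigmaD)
    show "((\<lambda>i. case (\<beta>, i) of (\<beta>, i) \<Rightarrow> f i) has_sum infsum f {i\<in>I. \<phi> i = \<beta>}) {i\<in>I. \<phi> i = \<beta>}" for \<beta>
      unfolding prod.case
      by (rule has_sum_infsum, rule summable_on_subset_banach[OF assms(1)]) auto
  qed
qed

section \<open>Power series on polydiscs\<close>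

definition polydisc :: "real \<Rightarrow> 'a::euclidean_space set" where
  "polydisc r = {y. \<forall>b\<in>Basis. \<bar>y \<bullet> b\<bar> \<le> r}"

definition degree_weight :: "real \<Rightarrow> ('a::euclidean_space \<Rightarrow> nat) \<Rightarrow> real" where
  "degree_weight r \<alpha> = r ^ sum \<alpha> Basis"

text \<open>\<open>B\<close> bounds the weighted l1 norm of the coefficients. This norm is
  submultiplicative and dominates the supremum on the closed polydisc; keeping track of it is what
  permits substitution into a one-variable power series later.\<close>

definition polydisc_series :: "real \<Rightarrow> real \<Rightarrow> ('a::euclidean_space \<Rightarrow> real) \<Rightarrow> bool" where
  "polydisc_series r B h \<longleftrightarrow>
     (\<exists>c. (\<lambda>\<alpha>. \<bar>c \<alpha>\<bar> * degree_weight r \<alpha>) summable_on multi_indices \<and>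
          infsum (\<lambda>\<alpha>. \<bar>c \<alpha>\<bar> * degree_weight r \<alpha>) multi_indices \<le> B \<and>
          (\<forall>y\<in>polydisc r. ((\<lambda>\<alpha>. c \<alpha> * multi_power y \<alpha>) has_sum h y) multi_indices))"

lemma polydisc_seriesI:
  assumes "(\<lambda>\<alpha>. \<bar>c \<alpha>\<bar> * degree_weight r \<alpha>) summable_on multi_indices"
    and "infsum (\<lambda>\<alpha>. \<bar>c \<alpha>\<bar> * degree_weight r \<alpha>) multi_indices \<le> B"
    and "\<And>y. y \<in> polydisc r \<Longrightarrow> ((\<lambda>\<alpha>. c \<alpha> * multi_power y \<alpha>) has_sum h y) multi_indices"
  shows "polydisc_series r B h"
  unfolding polydisc_series_def by (rule exI[of _ c]) (simp add: assms)

lemma polydisc_seriesE: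
  assumes "polydisc_series r B h"
  obtains c where "(\<lambda>\<alpha>. \<bar>c \<alpha>\<bar> * degree_weight r \<alpha>) summable_on multi_indices"
    and "infsum (\<lambda>\<alpha>. \<bar>c \<alpha>\<bar> * degree_weight r \<alpha>) multi_indices \<le> B"
    and "\<And>y. y \<in> polydisc r \<Longrightarrow> ((\<lambda>\<alpha>. c \<alpha> * multi_power y \<alpha>) has_sum h y) multi_indices"
  using assms unfolding polydisc_series_def by (elim exE conjE bspec) simp

lemma degree_weight_add: "degree_weight r (\<lambda>b. \<alpha> b + \<beta> b) = degree_weight r \<alpha> * degree_weight r \<beta>"
  by (simp add: degree_weight_def sum.distrib power_add)

lemma multi_power_add: "multi_power y (\<lambda>b. \<alpha> b + \<beta> b) = multi_power y \<alpha> * multi_power y \<beta>"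
  by (simp add: multi_power_def power_add prod.distrib)

lemma degree_weight_pos: "r > 0 \<Longrightarrow> degree_weight r \<alpha> > 0"
  by (simp add: degree_weight_def)

lemma abs_multi_power_le:
  assumes "y \<in> polydisc r"
  shows "\<bar>multi_power y \<alpha>\<bar> \<le> degree_weight r \<alpha>"
proof -
  have "\<bar>multi_power y \<alpha>\<bar> = (\<Prod>b\<in>Basis. \<bar>y \<bullet> b\<bar> ^ \<alpha> b)"
    by (simp add: multi_power_def abs_prod power_abs)
  also have "\<dots> \<le> (\<Prod>b\<in>Basis. r ^ \<alpha> b)"
    using assms by (intro prod_mono) (auto simp: polydisc_def intro: power_mono)
  finally show ?thesis
    by (simp add: degree_weight_def power_sum)
qed

lemma polydisc_series_cong:
  assumes "polydisc_series r B h" "\<And>y. y \<in> polydisc r \<Longrightarrow> h y = h' y"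
  shows "polydisc_series r B h'"
  using assms unfolding polydisc_series_def by force

lemma polydisc_series_mono:
  assumes "polydisc_series r B h" "B \<le> B'"
  shows "polydisc_series r B' h"
  using assms unfolding polydisc_series_def by (meson order_trans)

text \<open>Terms with equal multi-index may be collected afterwards, so a function may be expanded over
  any index set; sums, products and nested sums then need no separate rearrangement.\<close>

lemma polydisc_series_regroup:
  fixes \<phi> :: "'i \<Rightarrow> 'a::euclidean_space \<Rightarrow> nat" and c :: "'i \<Rightarrow> real"
  assumes r: "r > 0" and \<phi>: "\<phi> ` I \<subseteq> multi_indices"
    and sum: "((\<lambda>i. \<bar>c i\<bar> * degree_weight r (\<phi> i)) has_sum B) I"
    and h: "\<And>y. y \<in> polydisc r \<Longrightarrow> ((\<lambda>i. c i * multi_power y (\<phi> i)) has_sum h y) I"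
  shows "polydisc_series r B h"
proof -
  let ?F = "\<lambda>\<beta>. {i\<in>I. \<phi> i = \<beta>}"
  let ?w = "\<lambda>i. \<bar>c i\<bar> * degree_weight r (\<phi> i)"
  define C where "C \<beta> = infsum c (?F \<beta>)" for \<beta>
  have w: "?w summable_on I" "infsum ?w I = B"
    using sum by (auto simp: has_sum_iff)
  have wF: "(\<lambda>i. \<bar>c i\<bar> * degree_weight r \<beta>) summable_on ?F \<beta>" for \<beta>
    using summable_on_subset_banach[OF w(1), of "?F \<beta>"]
    by (subst summable_on_cong[of _ _ ?w]) auto
  \<comment> \<open>On a single fibre the weight is a positive constant and can be divided
    out.\<close>
  have absF: "(\<lambda>i. \<bar>c i\<bar>) summable_on ?F \<beta>" for \<beta>
  proof -
    have "(\<lambda>i. (\<bar>c i\<bar> * degree_weight r \<beta>) * inverse (degree_weight r \<beta>)) summable_on ?F \<beta>"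
      by (rule summable_on_cmult_left[OF wF])
    then show ?thesis
      using degree_weight_pos[OF r, of \<beta>] by (simp add: field_simps)
  qed
  have cF: "c summable_on ?F \<beta>" for \<beta>
    using absF by (subst summable_on_iff_abs_summable_on_real) auto
  have le: "\<bar>C \<beta>\<bar> * degree_weight r \<beta> \<le> infsum ?w (?F \<beta>)" for \<beta>
  proof -
    have "\<bar>C \<beta>\<bar> \<le> infsum (\<lambda>i. \<bar>c i\<bar>) (?F \<beta>)"
      using norm_infsum_bound[of c "?F \<beta>"] absF by (simp add: C_def)
    then have "\<bar>C \<beta>\<bar> * degree_weight r \<beta> \<le> infsum (\<lambda>i. \<bar>c i\<bar>) (?F \<beta>) * degree_weight r \<beta>"
      using degree_weight_pos[OF r, of \<beta>] by (intro mult_right_mono) auto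
    also have "\<dots> = infsum (\<lambda>i. \<bar>c i\<bar> * degree_weight r \<beta>) (?F \<beta>)"
      using absF by (simp add: infsum_cmult_left)
    also have "\<dots> = infsum ?w (?F \<beta>)"
      by (rule infsum_cong) auto
    finally show ?thesis .
  qed
  have W: "((\<lambda>\<beta>. infsum ?w (?F \<beta>)) has_sum B) multi_indices"
    using has_sum_fibres[OF w(1) \<phi>] w(2) by simp
  have Ws: "(\<lambda>\<beta>. infsum ?w (?F \<beta>)) summable_on multi_indices"
    by (rule has_sum_imp_summable[OF W])
  have 1: "(\<lambda>\<beta>. \<bar>C \<beta>\<bar> * degree_weight r \<beta>) summable_on multi_indices"
    by (rule summable_on_comparison_test[OF Ws le])
       (simp add: less_imp_le[OF degree_weight_pos[OF r]])
  have 2: "infsum (\<lambda>\<beta>. \<bar>C \<beta>\<bar> * degree_weight r \<beta>) multi_indices \<le> B"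
    using infsum_mono[OF 1 Ws le] infsumI[OF W] by simp
  have 3: "((\<lambda>\<beta>. C \<beta> * multi_power y \<beta>) has_sum h y) multi_indices" if y: "y \<in> polydisc r" for y
  proof -
    have "infsum (\<lambda>i. c i * multi_power y (\<phi> i)) (?F \<beta>) = C \<beta> * multi_power y \<beta>" for \<beta>
    proof -
      have "infsum (\<lambda>i. c i * multi_power y (\<phi> i)) (?F \<beta>) = infsum (\<lambda>i. c i * multi_power y \<beta>) (?F \<beta>)"
        by (rule infsum_cong) auto
      also have "\<dots> = C \<beta> * multi_power y \<beta>"
        using cF by (simp add: infsum_cmult_left C_def)
      finally show ?thesis .
    qed
    moreover have "(\<lambda>i. c i * multi_power y (\<phi> i)) summable_on I"
      "infsum (\<lambda>i. c i * multi_power y (\<phi> i)) I = h y"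
      using h[OF y] by (auto simp: has_sum_iff)
    ultimately show ?thesis
      using has_sum_fibres[OF _ \<phi>, of "\<lambda>i. c i * multi_power y (\<phi> i)"] by simp
  qed
  show ?thesis
    by (rule polydisc_seriesI[OF 1 2 3])
qed

lemma polydisc_series_bound_nonneg:
  fixes h :: "'a::euclidean_space \<Rightarrow> real"
  assumes "r > 0" "polydisc_series r B h"
  shows "B \<ge> 0"
proof -
  let ?M = "multi_indices :: ('a \<Rightarrow> nat) set"
  obtain c where "infsum (\<lambda>\<alpha>. \<bar>c \<alpha>\<bar> * degree_weight r \<alpha>) ?M \<le> B"
    by (rule polydisc_seriesE[OF assms(2)]) (rule that)
  moreover have "0 \<le> infsum (\<lambda>\<alpha>. \<bar>c \<alpha>\<bar> * degree_weight r \<alpha>) ?M"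
    by (rule infsum_nonneg) (simp add: less_imp_le[OF degree_weight_pos[OF assms(1)]])
  ultimately show ?thesis
    by linarith
qed

lemma polydisc_series_monomial:
  assumes "r > 0" "\<alpha> \<in> multi_indices"
  shows "polydisc_series r (\<bar>c\<bar> * degree_weight r \<alpha>) (\<lambda>y. c * multi_power y \<alpha>)"
  by (rule polydisc_series_regroup[where I = "{()}" and \<phi> = "\<lambda>_. \<alpha>" and c = "\<lambda>_. c"])
     (use assms in \<open>auto simp: has_sum_finite_iff\<close>)

lemma polydisc_series_const:
  assumes "r > 0"
  shows "polydisc_series r \<bar>c\<bar> (\<lambda>_ :: 'a::euclidean_space. c)"
  using polydisc_series_monomial[OF assms, of "\<lambda>_::'a. 0" c]
  by (simp add: multi_indices_def degree_weight_def multi_power_def)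

lemma polydisc_series_coordinate:
  assumes "r > 0" "b \<in> Basis"
  shows "polydisc_series r r (\<lambda>y. y \<bullet> b)"
proof -
  let ?\<alpha> = "\<lambda>b'. if b' = b then 1 else 0 :: nat"
  have "multi_power y ?\<alpha> = y \<bullet> b" for y
  proof -
    have "multi_power y ?\<alpha> = (\<Prod>b'\<in>Basis. if b' = b then y \<bullet> b else 1)"
      unfolding multi_power_def by (rule prod.cong) auto
    then show ?thesis
      using assms(2) by simp
  qed
  moreover have "degree_weight r ?\<alpha> = r"
    using assms(2) by (simp add: degree_weight_def)
  ultimately show ?thesis
    using polydisc_series_monomial[OF assms(1), of ?\<alpha> 1] assms(2) by (auto simp: multi_indices_def)
qed

text \<open>Fixing coefficients for every \<open>k\<close>, the double family over pairs
  \<open>(k, \<alpha>)\<close> is absolutely summable because the bounds are summable; regrouping it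
  along the second component gives one series. Since \<open>K\<close> may be infinite, this covers
  power series in a given function.\<close>

lemma polydisc_series_infsum:
  fixes h :: "'k \<Rightarrow> 'a::euclidean_space \<Rightarrow> real"
  assumes r: "r > 0" and h: "\<And>k. k \<in> K \<Longrightarrow> polydisc_series r (B k) (h k)"
    and B: "B summable_on K"
    and H: "\<And>y. y \<in> polydisc r \<Longrightarrow> ((\<lambda>k. h k y) has_sum H y) K"
  shows "polydisc_series r (infsum B K) H"
proof -
  have "\<exists>c. (\<lambda>\<alpha>. \<bar>c \<alpha>\<bar> * degree_weight r \<alpha>) summable_on multi_indices \<and>
          infsum (\<lambda>\<alpha>. \<bar>c \<alpha>\<bar> * degree_weight r \<alpha>) multi_indices \<le> B k \<and>
          (\<forall>y\<in>polydisc r. ((\<lambda>\<alpha>. c \<alpha> * multi_power y \<alpha>) has_sum h k y) multi_indices)" if "k \<in> K" for k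
    using h[OF that] unfolding polydisc_series_def .
  then have "\<exists>c. \<forall>k\<in>K. (\<lambda>\<alpha>. \<bar>c k \<alpha>\<bar> * degree_weight r \<alpha>) summable_on multi_indices \<and>
          infsum (\<lambda>\<alpha>. \<bar>c k \<alpha>\<bar> * degree_weight r \<alpha>) multi_indices \<le> B k \<and>
          (\<forall>y\<in>polydisc r. ((\<lambda>\<alpha>. c k \<alpha> * multi_power y \<alpha>) has_sum h k y) multi_indices)"
    by (intro bchoice ballI)
  then obtain c where "\<forall>k\<in>K. (\<lambda>\<alpha>. \<bar>c k \<alpha>\<bar> * degree_weight r \<alpha>) summable_on multi_indices \<and>
          infsum (\<lambda>\<alpha>. \<bar>c k \<alpha>\<bar> * degree_weight r \<alpha>) multi_indices \<le> B k \<and>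
          (\<forall>y\<in>polydisc r. ((\<lambda>\<alpha>. c k \<alpha> * multi_power y \<alpha>) has_sum h k y) multi_indices)"
    by (rule exE)
  note c = bspec[OF this, THEN conjunct1] bspec[OF this, THEN conjunct2, THEN conjunct1]
    bspec[OF this, THEN conjunct2, THEN conjunct2, THEN bspec]
  let ?I = "K \<times> (multi_indices :: ('a \<Rightarrow> nat) set)"
  let ?w = "\<lambda>(k, \<alpha>). \<bar>c k \<alpha>\<bar> * degree_weight r \<alpha>"
  let ?N = "\<lambda>k. infsum (\<lambda>\<alpha>. \<bar>c k \<alpha>\<bar> * degree_weight r \<alpha>) multi_indices"
  have w0: "\<bar>x\<bar> * degree_weight r \<alpha> \<ge> 0" for x and \<alpha> :: "'a \<Rightarrow> nat"
    using degree_weight_pos[OF r, of \<alpha>] by simp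
  have N: "?N summable_on K"
    by (rule summable_on_comparison_test[OF B]) (use c(2) in \<open>auto intro!: infsum_nonneg w0\<close>)
  have sumI: "?w summable_on ?I"
    by (rule summable_on_SigmaI[OF _ N]) (use c(1) in \<open>auto simp: w0\<close>)
  have "infsum ?w ?I = infsum ?N K"
    using infsum_Sigma_banach[OF sumI] by simp
  also have "\<dots> \<le> infsum B K"
    by (rule infsum_mono[OF N B]) (rule c(2))
  finally have le: "infsum ?w ?I \<le> infsum B K" .
  have "polydisc_series r (infsum ?w ?I) H"
  proof (rule polydisc_series_regroup[where \<phi> = snd and I = ?I and c = "\<lambda>(k, \<alpha>). c k \<alpha>", OF r])
    show "((\<lambda>i. \<bar>case i of (k, \<alpha>) \<Rightarrow> c k \<alpha>\<bar> * degree_weight r (snd i)) has_sum infsum ?w ?I) ?I"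
      using has_sum_infsum[OF sumI] by (simp add: case_prod_beta')
    fix y :: 'a assume y: "y \<in> polydisc r"
    have "(\<lambda>i. case i of (k, \<alpha>) \<Rightarrow> c k \<alpha> * multi_power y \<alpha>) summable_on ?I"
    proof (subst summable_on_iff_abs_summable_on_real, rule summable_on_comparison_test[OF sumI])
      show "norm (case i of (k, \<alpha>) \<Rightarrow> c k \<alpha> * multi_power y \<alpha>) \<le> ?w i" for i
        using abs_multi_power_le[OF y, of "snd i"]
        by (simp add: abs_mult case_prod_beta' mult_left_mono)
    qed auto
    then show "((\<lambda>i. (case i of (k, \<alpha>) \<Rightarrow> c k \<alpha>) * multi_power y (snd i)) has_sum H y) ?I"
      by (intro has_sum_SigmaI[OF _ H[OF y]]) (use c(3)[OF _ y] in \<open>auto simp: case_prod_beta'\<close>)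
  qed auto
  then show ?thesis
    using le by (rule polydisc_series_mono)
qed

text \<open>Only the first factor is expanded. Each of its monomials times \<open>h2\<close> shifts
  the multi-indices of the second series by \<open>\<alpha>\<close>, and the shifted series are then
  summed over \<open>\<alpha>\<close> by \<open>polydisc_series_infsum\<close>.\<close>

lemma polydisc_series_mult:
  fixes h1 h2 :: "'a::euclidean_space \<Rightarrow> real"
  assumes r: "r > 0" and "polydisc_series r B1 h1" "polydisc_series r B2 h2"
  shows "polydisc_series r (B1 * B2) (\<lambda>y. h1 y * h2 y)"
proof -
  let ?M = "multi_indices :: ('a \<Rightarrow> nat) set"
  obtain c1 where c1: "(\<lambda>\<alpha>. \<bar>c1 \<alpha>\<bar> * degree_weight r \<alpha>) summable_on ?M"
      "infsum (\<lambda>\<alpha>. \<bar>c1 \<alpha>\<bar> * degree_weight r \<alpha>) ?M \<le> B1"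
      "\<And>y. y \<in> polydisc r \<Longrightarrow> ((\<lambda>\<alpha>. c1 \<alpha> * multi_power y \<alpha>) has_sum h1 y) ?M"
    by (rule polydisc_seriesE[OF assms(2)]) (rule that)
  have w0: "\<bar>x\<bar> * degree_weight r \<alpha> \<ge> 0" for x and \<alpha> :: "'a \<Rightarrow> nat"
    using degree_weight_pos[OF r, of \<alpha>] by simp
  have B2: "B2 \<ge> 0"
    by (rule polydisc_series_bound_nonneg[OF r assms(3)])
  let ?N = "infsum (\<lambda>\<alpha>. \<bar>c1 \<alpha>\<bar> * degree_weight r \<alpha>) ?M"
  have "polydisc_series r (infsum (\<lambda>\<alpha>. (\<bar>c1 \<alpha>\<bar> * degree_weight r \<alpha>) * B2) ?M) (\<lambda>y. h1 y * h2 y)"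
  proof (rule polydisc_series_infsum[OF r])
    show "(\<lambda>\<alpha>. \<bar>c1 \<alpha>\<bar> * degree_weight r \<alpha> * B2) summable_on ?M"
      using c1(1) by (rule summable_on_cmult_left)
    show "((\<lambda>\<alpha>. (c1 \<alpha> * multi_power y \<alpha>) * h2 y) has_sum h1 y * h2 y) ?M"
      if "y \<in> polydisc r" for y
      using c1(3)[OF that] by (rule has_sum_cmult_left)
    fix \<alpha> :: "'a \<Rightarrow> nat" assume \<alpha>: "\<alpha> \<in> ?M"
    obtain c2 where c2: "(\<lambda>\<beta>. \<bar>c2 \<beta>\<bar> * degree_weight r \<beta>) summable_on ?M"
      "infsum (\<lambda>\<beta>. \<bar>c2 \<beta>\<bar> * degree_weight r \<beta>) ?M \<le> B2"
      "\<And>y. y \<in> polydisc r \<Longrightarrow> ((\<lambda>\<beta>. c2 \<beta> * multi_power y \<beta>) has_sum h2 y) ?M"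
      by (rule polydisc_seriesE[OF assms(3)]) (rule that)
    have "polydisc_series r ((\<bar>c1 \<alpha>\<bar> * degree_weight r \<alpha>) *
        infsum (\<lambda>\<beta>. \<bar>c2 \<beta>\<bar> * degree_weight r \<beta>) ?M) (\<lambda>y. (c1 \<alpha> * multi_power y \<alpha>) * h2 y)"
    proof (rule polydisc_series_regroup[where \<phi> = "\<lambda>\<beta> b. \<alpha> b + \<beta> b" and I = ?M
          and c = "\<lambda>\<beta>. c1 \<alpha> * c2 \<beta>", OF r])
      show "(\<lambda>\<beta> b. \<alpha> b + \<beta> b) ` ?M \<subseteq> ?M"
        using \<alpha> by (auto simp: multi_indices_def)
      show "((\<lambda>\<beta>. \<bar>c1 \<alpha> * c2 \<beta>\<bar> * degree_weight r (\<lambda>b. \<alpha> b + \<beta> b)) has_sum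
          (\<bar>c1 \<alpha>\<bar> * degree_weight r \<alpha>) * infsum (\<lambda>\<beta>. \<bar>c2 \<beta>\<bar> * degree_weight r \<beta>) ?M) ?M"
        using has_sum_cmult_right[OF has_sum_infsum[OF c2(1)], of "\<bar>c1 \<alpha>\<bar> * degree_weight r \<alpha>"]
        by (simp add: degree_weight_add abs_mult mult_ac)
      show "((\<lambda>\<beta>. c1 \<alpha> * c2 \<beta> * multi_power y (\<lambda>b. \<alpha> b + \<beta> b)) has_sum
          c1 \<alpha> * multi_power y \<alpha> * h2 y) ?M" if "y \<in> polydisc r" for y
        using has_sum_cmult_right[OF c2(3)[OF that], of "c1 \<alpha> * multi_power y \<alpha>"]
        by (simp add: multi_power_add mult_ac)
    qed
    then show "polydisc_series r ((\<bar>c1 \<alpha>\<bar> * degree_weight r \<alpha>) * B2) (\<lambda>y. (c1 \<alpha> * multi_power y \<alpha>) * h2 y)"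
      by (rule polydisc_series_mono) (intro mult_left_mono c2(2) w0)
  qed
  moreover have "infsum (\<lambda>\<alpha>. (\<bar>c1 \<alpha>\<bar> * degree_weight r \<alpha>) * B2) ?M = ?N * B2"
    using c1(1) by (simp add: infsum_cmult_left)
  ultimately show ?thesis
    using c1(2) B2 by (metis polydisc_series_mono mult_right_mono)
qed

lemma polydisc_series_power:
  assumes "r > 0" "polydisc_series r B h"
  shows "polydisc_series r (B ^ k) (\<lambda>y. h y ^ k)"
proof (induction k)
  case 0
  then show ?case
    using polydisc_series_const[OF assms(1), of 1] by simp
next
  case (Suc k)
  then show ?case
    using polydisc_series_mult[OF assms(1) assms(2) Suc] by simp
qed

lemma polydisc_series_add:
  assumes "r > 0" "polydisc_series r B1 h1" "polydisc_series r B2 h2"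
  shows "polydisc_series r (B1 + B2) (\<lambda>y. h1 y + h2 y)"
  using polydisc_series_infsum[of r "UNIV :: bool set" "\<lambda>b. if b then B1 else B2"
      "\<lambda>b y. if b then h1 y else h2 y" "\<lambda>y. h1 y + h2 y"] assms
  by (simp add: UNIV_bool has_sum_finite_iff add.commute)

text \<open>Every nonconstant monomial has degree at least 1, so shrinking the polydisc scales the bound
  of a series without constant term.\<close>

lemma polydisc_series_shrink:
  fixes h :: "'a::euclidean_space \<Rightarrow> real"
  assumes "polydisc_series r B h" "0 < s" "s \<le> r"
  shows "polydisc_series s B h" and "h 0 = 0 \<Longrightarrow> polydisc_series s (s / r * B) h"
proof -
  let ?M = "multi_indices :: ('a \<Rightarrow> nat) set"
  obtain c where c: "(\<lambda>\<alpha>. \<bar>c \<alpha>\<bar> * degree_weight r \<alpha>) summable_on ?M"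
      "infsum (\<lambda>\<alpha>. \<bar>c \<alpha>\<bar> * degree_weight r \<alpha>) ?M \<le> B"
      "\<And>y. y \<in> polydisc r \<Longrightarrow> ((\<lambda>\<alpha>. c \<alpha> * multi_power y \<alpha>) has_sum h y) ?M"
    by (rule polydisc_seriesE[OF assms(1)]) (rule that)
  have sub: "polydisc s \<subseteq> (polydisc r :: 'a set)"
    using assms(3) by (auto simp: polydisc_def)
  \<comment> \<open>Both claims compare weights termwise, with factor \<open>t = 1\<close> for the
    first and \<open>t = s / r\<close> for the second.\<close>
  have main: "polydisc_series s (t * B) h"
    if t: "t \<ge> 0" and le: "\<And>\<alpha>. \<alpha> \<in> ?M \<Longrightarrow> \<bar>c \<alpha>\<bar> * degree_weight s \<alpha> \<le> t * (\<bar>c \<alpha>\<bar> * degree_weight r \<alpha>)" for t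
  proof -
    have tc: "(\<lambda>\<alpha>. t * (\<bar>c \<alpha>\<bar> * degree_weight r \<alpha>)) summable_on ?M"
      using c(1) by (rule summable_on_cmult_right)
    have S: "(\<lambda>\<alpha>. \<bar>c \<alpha>\<bar> * degree_weight s \<alpha>) summable_on ?M"
      by (intro summable_on_comparison_test[OF tc] le mult_nonneg_nonneg abs_ge_zero
          less_imp_le[OF degree_weight_pos[OF assms(2)]])
    have "infsum (\<lambda>\<alpha>. \<bar>c \<alpha>\<bar> * degree_weight s \<alpha>) ?M \<le> infsum (\<lambda>\<alpha>. t * (\<bar>c \<alpha>\<bar> * degree_weight r \<alpha>)) ?M"
      by (rule infsum_mono[OF S tc le])
    also have "\<dots> = t * infsum (\<lambda>\<alpha>. \<bar>c \<alpha>\<bar> * degree_weight r \<alpha>) ?M"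
      using c(1) by (simp add: infsum_cmult_right)
    also have "\<dots> \<le> t * B"
      using c(2) t by (rule mult_left_mono)
    finally show ?thesis
      by (rule polydisc_seriesI[where c = c, OF S]) (use c(3) sub in auto)
  qed
  have le1: "degree_weight s \<alpha> \<le> degree_weight r \<alpha>" for \<alpha> :: "'a \<Rightarrow> nat"
    using assms by (auto simp: degree_weight_def intro!: power_mono)
  show "polydisc_series s B h"
    using main[of 1] le1 by (simp add: mult_left_mono)
  assume h0: "h 0 = 0"
  \<comment> \<open>At the origin every nonconstant monomial vanishes, so the series reduces there
    to its constant coefficient.\<close>
  have "c (\<lambda>_. 0) = 0"
  proof -
    have "0 \<in> (polydisc r :: 'a set)"
      using assms by (simp add: polydisc_def)
    then have 1: "((\<lambda>\<alpha>. c \<alpha> * multi_power 0 \<alpha>) has_sum 0) ?M"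
      using c(3)[of 0] h0 by simp
    have 0: "multi_power 0 \<alpha> = 0" if \<alpha>: "\<alpha> \<in> ?M" "\<alpha> \<noteq> (\<lambda>_. 0)" for \<alpha>
    proof -
      obtain b where "\<alpha> b \<noteq> 0" using \<alpha>(2) by auto
      then show ?thesis
        using \<alpha>(1) by (auto simp: multi_power_def multi_indices_def intro!: prod_zero bexI[of _ b])
    qed
    have "((\<lambda>\<alpha>. c \<alpha> * multi_power 0 \<alpha>) has_sum c (\<lambda>_. 0)) ?M"
      by (rule has_sum_finite_neutralI[of "{\<lambda>_. 0}"])
         (use 0 in \<open>auto simp: multi_indices_def multi_power_def\<close>)
    then show ?thesis
      using 1 has_sum_unique by blast
  qed
  moreover have "degree_weight s \<alpha> \<le> s / r * degree_weight r \<alpha>"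
    if \<alpha>: "\<alpha> \<in> ?M" "\<alpha> \<noteq> (\<lambda>_. 0)" for \<alpha>
  proof -
    obtain b where "\<alpha> b \<noteq> 0" using \<alpha>(2) by auto
    then have "sum \<alpha> Basis \<noteq> 0"
      using \<alpha>(1) by (auto simp: multi_indices_def)
    then obtain k where k: "sum \<alpha> Basis = Suc k"
      using not0_implies_Suc by blast
    have "s ^ k \<le> r ^ k"
      using assms by (auto intro: power_mono)
    then show ?thesis
      using assms by (simp add: degree_weight_def k mult_left_mono)
  qed
  ultimately have "\<bar>c \<alpha>\<bar> * degree_weight s \<alpha> \<le> \<bar>c \<alpha>\<bar> * (s / r * degree_weight r \<alpha>)"
    if "\<alpha> \<in> ?M" for \<alpha>
    using that by (cases "\<alpha> = (\<lambda>_. 0)") (simp, blast intro: mult_left_mono abs_ge_zero)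
  then show "polydisc_series s (s / r * B) h"
    using assms by (intro main) (simp_all only: divide_nonneg_pos less_imp_le mult.left_commute)
qed

text \<open>This is the binomial series in \<open>h\<close>. Its terms have norm at most
  \<open>\<bar>s gchoose n\<bar> * B ^ n\<close>, which is summable for \<open>B < 1\<close>, and
  values on the polydisc are bounded by the norm.\<close>

lemma polydisc_series_powr:
  fixes h :: "'a::euclidean_space \<Rightarrow> real"
  assumes r: "r > 0" and h: "polydisc_series r B h" and B: "0 \<le> B" "B < 1"
  shows "\<exists>B'. polydisc_series r B' (\<lambda>y. (1 + h y) powr s)"
    and "\<And>y. y \<in> polydisc r \<Longrightarrow> \<bar>h y\<bar> < 1"
proof -
  have bnd: "\<bar>h y\<bar> \<le> B" if y: "y \<in> polydisc r" for y
  proof -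
    let ?M = "multi_indices :: ('a \<Rightarrow> nat) set"
    obtain c where c: "(\<lambda>\<alpha>. \<bar>c \<alpha>\<bar> * degree_weight r \<alpha>) summable_on ?M"
        "infsum (\<lambda>\<alpha>. \<bar>c \<alpha>\<bar> * degree_weight r \<alpha>) ?M \<le> B"
        "\<And>y. y \<in> polydisc r \<Longrightarrow> ((\<lambda>\<alpha>. c \<alpha> * multi_power y \<alpha>) has_sum h y) ?M"
      by (rule polydisc_seriesE[OF h]) (rule that)
    have "\<bar>c \<alpha> * multi_power y \<alpha>\<bar> \<le> \<bar>c \<alpha>\<bar> * degree_weight r \<alpha>" for \<alpha>
      using abs_multi_power_le[OF y] by (auto simp: abs_mult intro: mult_left_mono)
    moreover have "c \<alpha> * multi_power y \<alpha> \<le> \<bar>c \<alpha> * multi_power y \<alpha>\<bar>"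
      "- (c \<alpha> * multi_power y \<alpha>) \<le> \<bar>c \<alpha> * multi_power y \<alpha>\<bar>" for \<alpha>
      by auto
    ultimately have "h y \<le> infsum (\<lambda>\<alpha>. \<bar>c \<alpha>\<bar> * degree_weight r \<alpha>) ?M"
      "- h y \<le> infsum (\<lambda>\<alpha>. \<bar>c \<alpha>\<bar> * degree_weight r \<alpha>) ?M"
      using has_sum_mono[OF c(3)[OF y] has_sum_infsum[OF c(1)]]
        has_sum_mono[OF has_sum_uminusI[OF c(3)[OF y]] has_sum_infsum[OF c(1)]]
      by (meson order_trans)+
    then show ?thesis
      using c(2) by linarith
  qed
  then show "\<And>y. y \<in> polydisc r \<Longrightarrow> \<bar>h y\<bar> < 1"
    using B(2) by force
  \<comment> \<open>The point \<open>(1 + B) / 2\<close> lies strictly between \<open>B\<close> and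
    1. Convergence there gives absolute convergence for all smaller arguments.\<close>
  have summ: "summable (\<lambda>n. norm ((s gchoose n) * z ^ n))" if "\<bar>z\<bar> \<le> B" for z
  proof (rule powser_insidea)
    show "summable (\<lambda>n. (s gchoose n) * ((1 + B) / 2) ^ n)"
      using gen_binomial_real[of "(1 + B) / 2" s] B sums_summable by auto
    show "norm z < norm ((1 + B) / 2)"
      using B that by auto
  qed
  let ?B = "\<lambda>n. \<bar>s gchoose n\<bar> * B ^ n"
  have "polydisc_series r (infsum ?B UNIV) (\<lambda>y. (1 + h y) powr s)"
  proof (rule polydisc_series_infsum[OF r])
    show "polydisc_series r (?B n) (\<lambda>y. (s gchoose n) * h y ^ n)" for n
      by (rule polydisc_series_mult[OF r polydisc_series_const[OF r] polydisc_series_power[OF r h]])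
    show "?B summable_on UNIV"
      using summ[of B] B by (intro norm_summable_imp_summable_on) (simp add: abs_mult)
    fix y :: 'a assume y: "y \<in> polydisc r"
    show "((\<lambda>n. (s gchoose n) * h y ^ n) has_sum (1 + h y) powr s) UNIV"
      by (rule norm_summable_imp_has_sum[OF summ[OF bnd[OF y]]])
         (use bnd[OF y] B in \<open>auto intro: gen_binomial_real\<close>)
  qed
  then show "\<exists>B'. polydisc_series r B' (\<lambda>y. (1 + h y) powr s)" by blast
qed

section \<open>Analytic germs\<close>

text \<open>Germs live on full ambient neighbourhoods and are scalar valued, so closure properties
  can be proved without reference to a subset; \<open>real_analytic_onI\<close> passes to
  vector-valued maps on a set.\<close>

definition analytic_germ :: "('a::euclidean_space \<Rightarrow> real) \<Rightarrow> 'a \<Rightarrow> bool" where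
  "analytic_germ f a \<longleftrightarrow> (\<exists>r>0. \<exists>B. polydisc_series r B (\<lambda>y. f (a + y)))"

lemma analytic_germ_const [intro]: "analytic_germ (\<lambda>_. c) a"
  unfolding analytic_germ_def by (intro exI conjI, rule zero_less_one) (rule polydisc_series_const, simp)

lemma analytic_germ_common_radius:
  assumes "analytic_germ f a" "analytic_germ g a"
  obtains r B1 B2 where "r > 0" "polydisc_series r B1 (\<lambda>y. f (a + y))"
    "polydisc_series r B2 (\<lambda>y. g (a + y))"
proof -
  obtain r1 B1 r2 B2 where "r1 > 0" "r2 > 0"
    "polydisc_series r1 B1 (\<lambda>y. f (a + y))" "polydisc_series r2 B2 (\<lambda>y. g (a + y))"
    using assms unfolding analytic_germ_def by blast
  then show thesis
    by (intro that[of "min r1 r2" B1 B2])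
       (simp, (erule polydisc_series_shrink(1); simp)+)
qed

lemma analytic_germ_add [intro]:
  "analytic_germ f a \<Longrightarrow> analytic_germ g a \<Longrightarrow> analytic_germ (\<lambda>x. f x + g x) a"
  unfolding analytic_germ_def[of "\<lambda>x. f x + g x"]
  by (erule (1) analytic_germ_common_radius) (intro exI conjI, assumption, rule polydisc_series_add)

lemma analytic_germ_mult [intro]:
  "analytic_germ f a \<Longrightarrow> analytic_germ g a \<Longrightarrow> analytic_germ (\<lambda>x. f x * g x) a"
  unfolding analytic_germ_def[of "\<lambda>x. f x * g x"]
  by (erule (1) analytic_germ_common_radius) (intro exI conjI, assumption, rule polydisc_series_mult)

lemma analytic_germ_minus [intro]: "analytic_germ f a \<Longrightarrow> analytic_germ (\<lambda>x. - f x) a"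
  using analytic_germ_mult[OF analytic_germ_const[of "-1"], of f a] by simp

lemma analytic_germ_diff [intro]:
  "analytic_germ f a \<Longrightarrow> analytic_germ g a \<Longrightarrow> analytic_germ (\<lambda>x. f x - g x) a"
  using analytic_germ_add[of f a "\<lambda>x. - g x"] analytic_germ_minus[of g a] by simp

lemma analytic_germ_sum [intro]:
  "(\<And>i. i \<in> I \<Longrightarrow> analytic_germ (f i) a) \<Longrightarrow> analytic_germ (\<lambda>x. \<Sum>i\<in>I. f i x) a"
  by (induction I rule: infinite_finite_induct) auto

lemma analytic_germ_prod [intro]:
  "(\<And>i. i \<in> I \<Longrightarrow> analytic_germ (f i) a) \<Longrightarrow> analytic_germ (\<lambda>x. \<Prod>i\<in>I. f i x) a"
  by (induction I rule: infinite_finite_induct) auto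

lemma analytic_germ_coordinate:
  assumes "b \<in> Basis"
  shows "analytic_germ (\<lambda>x. x \<bullet> b) a"
proof -
  have "polydisc_series 1 (\<bar>a \<bullet> b\<bar> + 1) (\<lambda>y. a \<bullet> b + y \<bullet> b)"
    by (intro polydisc_series_add polydisc_series_const polydisc_series_coordinate assms) simp_all
  then show ?thesis
    unfolding analytic_germ_def inner_add_left by - (intro exI conjI, rule zero_less_one)
qed

text \<open>Write \<open>f\<close> as \<open>f a\<close> times \<open>1 + g\<close> with
  \<open>g\<close> vanishing at \<open>a\<close>; on a small enough polydisc the norm of
  \<open>g\<close> drops below 1 and the binomial series applies. \<open>G\<close> is prescribed on
  positive arguments only, so that \<open>inverse\<close> and \<open>sqrt\<close> become
  instances.\<close>

lemma analytic_germ_powr: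
  fixes f :: "'a::euclidean_space \<Rightarrow> real"
  assumes f: "analytic_germ f a" and pos: "f a > 0" and G: "\<And>x. x > 0 \<Longrightarrow> G x = x powr s"
  shows "analytic_germ (\<lambda>x. G (f x)) a"
proof -
  let ?g = "\<lambda>x. (f x - f a) * inverse (f a)"
  have "analytic_germ ?g a"
    by (intro analytic_germ_mult analytic_germ_diff analytic_germ_const f)
  then obtain r B where r: "r > 0" and B: "polydisc_series r B (\<lambda>y. ?g (a + y))"
    unfolding analytic_germ_def by blast
  have B0: "B \<ge> 0"
    using polydisc_series_bound_nonneg[OF r B] .
  \<comment> \<open>The denominator contains \<open>B + 1\<close>, which stays positive when
    \<open>B = 0\<close> and still makes the shrunken bound at most
    \<open>B / (2 * (B + 1))\<close>.\<close>
  define t where "t = min r (r / (2 * (B + 1)))"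
  have t: "0 < t" "t \<le> r"
    using r B0 by (auto simp: t_def)
  have "t / r * B \<le> (r / (2 * (B + 1))) / r * B"
    using r B0 by (intro mult_right_mono divide_right_mono) (auto simp: t_def)
  also have "\<dots> = B / (2 * (B + 1))"
    using r by simp
  also have "\<dots> < 1"
    using B0 by (simp add: divide_less_eq)
  finally have tB: "t / r * B < 1" .
  have "polydisc_series t (t / r * B) (\<lambda>y. ?g (a + y))"
    by (rule polydisc_series_shrink(2)[OF B t]) simp
  note P = polydisc_series_powr[OF t(1) this _ tB]
  obtain B' where B': "polydisc_series t B' (\<lambda>y. (1 + ?g (a + y)) powr s)"
    using P(1) t r B0 by auto
  have "polydisc_series t (\<bar>f a powr s\<bar> * B') (\<lambda>y. f a powr s * (1 + ?g (a + y)) powr s)"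
    by (rule polydisc_series_mult[OF t(1) polydisc_series_const[OF t(1)] B'])
  then have "polydisc_series t (\<bar>f a powr s\<bar> * B') (\<lambda>y. G (f (a + y)))"
  proof (rule polydisc_series_cong)
    fix y :: 'a assume "y \<in> polydisc t"
    then have "\<bar>?g (a + y)\<bar> < 1"
      using P(2) t r B0 by simp
    then have g: "1 + ?g (a + y) > 0"
      by linarith
    have "f a * (1 + ?g (a + y)) = f (a + y)"
      using pos by (simp add: field_simps)
    moreover from this have "f (a + y) > 0"
      using g pos by (metis mult_pos_pos)
    ultimately show "f a powr s * (1 + ?g (a + y)) powr s = G (f (a + y))"
      using g pos G[of "f (a + y)"] by (metis less_imp_le powr_mult)
  qed
  then show ?thesis
    unfolding analytic_germ_def using t(1) by blast
qed

lemma analytic_germ_inverse: "analytic_germ f a \<Longrightarrow> f a > 0 \<Longrightarrow> analytic_germ (\<lambda>x. inverse (f x)) a"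
  by (rule analytic_germ_powr[where s = "-1"]) (auto simp: powr_minus)

lemma analytic_germ_divide:
  "analytic_germ f a \<Longrightarrow> analytic_germ g a \<Longrightarrow> g a > 0 \<Longrightarrow> analytic_germ (\<lambda>x. f x / g x) a"
  unfolding divide_inverse by (intro analytic_germ_mult analytic_germ_inverse)

lemma analytic_germ_sqrt: "analytic_germ f a \<Longrightarrow> f a > 0 \<Longrightarrow> analytic_germ (\<lambda>x. sqrt (f x)) a"
  by (rule analytic_germ_powr[where s = "1 / 2"]) (auto simp: powr_half_sqrt)

text \<open>The map \<open>f\<close> need only agree on \<open>S\<close> with some \<open>g\<close>
  that is analytic around its points. Later \<open>f\<close> comes from \<open>Phi\<close> or its
  inverse, with no control off \<open>S\<close>, and \<open>g\<close> is an explicit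
  formula.\<close>

lemma real_analytic_onI:
  fixes f :: "'a::euclidean_space \<Rightarrow> 'b::euclidean_space"
  assumes "\<And>a b. a \<in> S \<Longrightarrow> b \<in> Basis \<Longrightarrow> analytic_germ (\<lambda>x. g x \<bullet> b) a"
    and fg: "\<And>x. x \<in> S \<Longrightarrow> f x = g x"
  shows "real_analytic_on f S"
  unfolding real_analytic_on_def
proof
  let ?M = "multi_indices :: ('a \<Rightarrow> nat) set"
  fix a assume "a \<in> S"
  then have "\<forall>b\<in>Basis. \<exists>r>0. \<exists>B. polydisc_series r B (\<lambda>y. g (a + y) \<bullet> b)"
    using assms(1) unfolding analytic_germ_def by blast
  then obtain \<rho> where \<rho>: "\<And>b. b \<in> Basis \<Longrightarrow> \<rho> b > 0"
      "\<And>b. b \<in> Basis \<Longrightarrow> \<exists>B. polydisc_series (\<rho> b) B (\<lambda>y. g (a + y) \<bullet> b)"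
    by metis
  define r where "r = Min (\<rho> ` Basis)"
  have r: "r > 0" "\<And>b. b \<in> Basis \<Longrightarrow> r \<le> \<rho> b"
    using \<rho>(1) by (auto simp: r_def)
  have "\<forall>b\<in>Basis. \<exists>c. \<forall>y\<in>polydisc r. ((\<lambda>\<alpha>. c \<alpha> * multi_power y \<alpha>) has_sum g (a + y) \<bullet> b) ?M"
  proof
    fix b :: 'b assume b: "b \<in> Basis"
    obtain B where "polydisc_series (\<rho> b) B (\<lambda>y. g (a + y) \<bullet> b)"
      using \<rho>(2)[OF b] by blast
    then have "polydisc_series r B (\<lambda>y. g (a + y) \<bullet> b)"
      by (rule polydisc_series_shrink(1)) (use r b in auto)
    then show "\<exists>c. \<forall>y\<in>polydisc r. ((\<lambda>\<alpha>. c \<alpha> * multi_power y \<alpha>) has_sum g (a + y) \<bullet> b) ?M"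
      unfolding polydisc_series_def by blast
  qed
  then obtain c where c: "\<And>b y. b \<in> Basis \<Longrightarrow> y \<in> polydisc r \<Longrightarrow>
      ((\<lambda>\<alpha>. c b \<alpha> * multi_power y \<alpha>) has_sum g (a + y) \<bullet> b) ?M"
    by metis
  have *: "((\<lambda>\<alpha>. multi_power (x - a) \<alpha> *\<^sub>R (\<Sum>b\<in>Basis. c b \<alpha> *\<^sub>R b)) has_sum g x) ?M"
    if "x \<in> ball a r" for x
  proof -
    have "\<bar>(x - a) \<bullet> b\<bar> \<le> r" if "b \<in> Basis" for b
      using Basis_le_norm[OF that, of "x - a"] \<open>x \<in> ball a r\<close> by (simp add: dist_norm norm_minus_commute)
    then have y: "x - a \<in> polydisc r"
      by (simp add: polydisc_def)
    have "((\<lambda>\<alpha>. \<Sum>b\<in>B. (c b \<alpha> * multi_power (x - a) \<alpha>) *\<^sub>R b) has_sum (\<Sum>b\<in>B. (g x \<bullet> b) *\<^sub>R b)) ?M"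
      if "finite B" "B \<subseteq> Basis" for B
      using that
    proof (induction B rule: finite_induct)
      case (insert b B)
      have "((\<lambda>\<alpha>. (c b \<alpha> * multi_power (x - a) \<alpha>) *\<^sub>R b) has_sum (g x \<bullet> b) *\<^sub>R b) ?M"
        using c[OF _ y, of b] insert
        by (intro has_sum_bounded_linear[OF bounded_linear_scaleR_left]) auto
      then show ?case
        using insert by (simp add: has_sum_add)
    qed auto
    from this[of Basis] show ?thesis
      by (simp add: scaleR_sum_right euclidean_representation mult.commute)
  qed
  show "\<exists>r>0. \<exists>c. (\<forall>x\<in>ball a r. (\<lambda>\<alpha>. multi_power (x - a) \<alpha> *\<^sub>R c \<alpha>) summable_on ?M) \<and>
      (\<forall>x\<in>S \<inter> ball a r. ((\<lambda>\<alpha>. multi_power (x - a) \<alpha> *\<^sub>R c \<alpha>) has_sum f x) ?M)"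
  proof (rule exI[of _ r], rule conjI[OF r(1)], rule exI, intro conjI ballI)
    fix x assume "x \<in> ball a r"
    then show "(\<lambda>\<alpha>. multi_power (x - a) \<alpha> *\<^sub>R (\<Sum>b\<in>Basis. c b \<alpha> *\<^sub>R b)) summable_on ?M"
      by (rule has_sum_imp_summable[OF *])
  next
    fix x assume "x \<in> S \<inter> ball a r"
    then show "((\<lambda>\<alpha>. multi_power (x - a) \<alpha> *\<^sub>R (\<Sum>b\<in>Basis. c b \<alpha> *\<^sub>R b)) has_sum f x) ?M"
      using *[of x] fg[of x] by simp
  qed
qed

section \<open>Conjugation by permutation matrices\<close>

text \<open>The prefix syntax \<open>inv\<close> belongs to groups here.\<close>

abbreviation perm_inv :: "('n \<Rightarrow> 'n) \<Rightarrow> 'n \<Rightarrow> 'n" where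
  "perm_inv \<equiv> inv_into UNIV"

definition perm_matrix :: "('n \<Rightarrow> 'n) \<Rightarrow> real^'n^'n" where
  "perm_matrix p = (\<chi> i j. if i = p j then 1 else 0)"

text \<open>The matrix \<sigma> conjugates by relabelling rows and columns;
  \<open>perm_matrix_conj\<close> identifies this with the actual conjugation.\<close>

definition permute_conj :: "('n \<Rightarrow> 'n) \<Rightarrow> real^'n^'n \<Rightarrow> real^'n^'n" where
  "permute_conj p A = (\<chi> i j. A $ perm_inv p i $ perm_inv p j)"

lemma permute_conj_mult:
  assumes "bij p"
  shows "permute_conj p (A ** B) = permute_conj p A ** permute_conj p B"
proof -
  have "(\<Sum>k\<in>UNIV. A $ perm_inv p i $ k * B $ k $ perm_inv p j)
      = (\<Sum>k\<in>UNIV. A $ perm_inv p i $ perm_inv p k * B $ perm_inv p k $ perm_inv p j)" for i j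
    using sum.reindex_bij_betw[OF bij_imp_bij_inv[OF assms], of "\<lambda>k. A $ perm_inv p i $ k * B $ k $ perm_inv p j"]
    by simp
  then show ?thesis
    by (simp add: permute_conj_def matrix_matrix_mult_def)
qed

lemma permute_conj_inv:
  assumes "bij p"
  shows "permute_conj (perm_inv p) (permute_conj p A) = A" "permute_conj p (permute_conj (perm_inv p) A) = A"
  using assms by (simp_all add: permute_conj_def vec_eq_iff inv_inv_eq bij_is_inj bij_is_surj surj_f_inv_f)

lemma permute_conj_transpose: "permute_conj p (transpose A) = transpose (permute_conj p A)"
  by (simp add: permute_conj_def transpose_def)

lemma permute_conj_one: "bij p \<Longrightarrow> permute_conj p (mat 1) = mat 1"
  by (simp add: permute_conj_def mat_def vec_eq_iff bij_imp_bij_inv bij_is_inj inj_eq)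

lemma permutation_matrix_perm_matrix: "bij p \<Longrightarrow> permutation_matrix (perm_matrix p)"
  unfolding permutation_matrix_def perm_matrix_def by blast

lemma matrix_inv_perm_matrix:
  assumes "bij p"
  shows "matrix_inv (perm_matrix p) = perm_matrix (perm_inv p)"
proof -
  have "j = p i \<longleftrightarrow> i = perm_inv p j" for i j
    using assms by (metis bij_inv_eq_iff)
  then show ?thesis
    unfolding permutation_matrix_inverse(1)[OF permutation_matrix_perm_matrix[OF assms]]
    by (simp add: perm_matrix_def transpose_def)
qed

lemma perm_matrix_conj:
  assumes "bij p"
  shows "perm_matrix p ** A ** matrix_inv (perm_matrix p) = permute_conj p A"
proof -
  have eq: "i = p k \<longleftrightarrow> k = perm_inv p i" for i k
    using assms by (metis bij_inv_eq_iff)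
  show ?thesis
    unfolding permutation_matrix_inverse(1)[OF permutation_matrix_perm_matrix[OF assms]]
    by (simp add: perm_matrix_def permute_conj_def eq matrix_matrix_mult_def transpose_def
        mult_delta_left mult_delta_right)
qed

lemma unit_lower_sub_perm_matrix:
  fixes p :: "'n::{finite,wellorder} \<Rightarrow> 'n"
  assumes "bij p"
  shows "unit_lower_sub (perm_matrix p) = {l \<in> unit_lower. permute_conj (perm_inv p) l \<in> unit_lower}"
  unfolding unit_lower_sub_def perm_matrix_conj[OF assms]
  using permute_conj_inv[OF assms] by (auto simp: image_iff) metis

text \<open>Conjugation is multiplicative, so the conjugate of \<open>b\<close> is the inverse of
  the conjugate of \<open>a\<close>, and unit lower triangular matrices are closed under
  inversion.\<close>

lemma permute_conj_inverse_unit_lower: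
  fixes a :: "real^'n::{finite,wellorder}^'n::{finite,wellorder}"
  assumes p: "bij p" and a: "permute_conj p a \<in> unit_lower" and b: "a ** b = mat 1"
  shows "permute_conj p b \<in> unit_lower"
proof -
  obtain m where m: "m \<in> unit_lower" "m ** permute_conj p a = mat 1"
    using unit_lower_inverse[OF a] by metis
  have "m = m ** permute_conj p (a ** b)"
    using p by (simp add: b permute_conj_one)
  also have "\<dots> = (m ** permute_conj p a) ** permute_conj p b"
    using p by (simp only: permute_conj_mult matrix_mul_assoc)
  finally have "permute_conj p b = m"
    by (simp add: m(2))
  then show ?thesis
    by (simp add: m(1))
qed

lemma unit_lower_sub_inverse:
  fixes a :: "real^'n::{finite,wellorder}^'n::{finite,wellorder}"
  assumes "bij p" "a \<in> unit_lower_sub (perm_matrix p)" "b \<in> unit_lower" "a ** b = mat 1"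
  shows "b \<in> unit_lower_sub (perm_matrix p)"
  using assms permute_conj_inverse_unit_lower[of "perm_inv p" a b]
  by (simp add: unit_lower_sub_perm_matrix bij_imp_bij_inv)

text \<open>Even for an odd permutation the determinant is preserved, since those of \<sigma> and
  its inverse cancel.\<close>

lemma rotation_matrix_permute_conj:
  fixes q :: "real^'n^'n"
  assumes "bij p" "rotation_matrix q"
  shows "rotation_matrix (permute_conj p q)"
proof -
  have "transpose (permute_conj p q) ** permute_conj p q = permute_conj p (transpose q ** q)"
    by (simp add: permute_conj_mult[OF assms(1)] permute_conj_transpose)
  then have "orthogonal_matrix (permute_conj p q)"
    using assms by (simp add: rotation_matrix_def orthogonal_matrix permute_conj_one)
  moreover have "det (permute_conj p q) = det q"
  proof -
    have "matrix_inv (perm_matrix p) ** perm_matrix p = (mat 1 :: real^'n^'n)"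
      by (rule permutation_matrix_inverse(3)[OF permutation_matrix_perm_matrix[OF assms(1)]])
    then have "det (matrix_inv (perm_matrix p)) * det (perm_matrix p :: real^'n^'n) = 1"
      by (metis det_I det_mul)
    then show ?thesis
      by (simp add: perm_matrix_conj[OF assms(1), symmetric] det_mul mult_ac)
  qed
  ultimately show ?thesis
    using assms(2) by (simp add: rotation_matrix_def)
qed

section \<open>Uniqueness of the factorizations\<close>

definition pos_upper :: "real^'n::{finite,wellorder}^'n::{finite,wellorder} \<Rightarrow> bool" where
  "pos_upper r \<longleftrightarrow> upper_triangular r \<and> (\<forall>i. r $ i $ i > 0)"

section \<open>Products and inverses of triangular matrices\<close>

lemma upper_triangular_mult:
  fixes A B :: "real^'n::{finite,wellorder}^'n::{finite,wellorder}"
  assumes "upper_triangular A" "upper_triangular B"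
  shows "upper_triangular (A ** B)" "(A ** B) $ i $ i = A $ i $ i * B $ i $ i"
proof -
  have A: "A $ i $ j = 0" and B: "B $ i $ j = 0" if "j < i" for i j
    using assms that by (auto simp: upper_triangular_def)
  show "upper_triangular (A ** B)"
    unfolding upper_triangular_def
  proof (intro allI impI)
    fix i j :: 'n assume "j < i"
    then have "A $ i $ k * B $ k $ j = 0" for k
      using A[of k i] B[of j k] by (cases "k < i") auto
    then have "(\<Sum>k\<in>UNIV. A $ i $ k * B $ k $ j) = 0"
      by (intro sum.neutral) blast
    then show "(A ** B) $ i $ j = 0"
      by (simp add: matrix_matrix_mult_def)
  qed
  have "A $ i $ k * B $ k $ i = (if k = i then A $ i $ i * B $ i $ i else 0)" for k
    using A[of k i] B[of i k] by (cases k i rule: linorder_cases) auto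
  then have "(\<Sum>k\<in>UNIV. A $ i $ k * B $ k $ i) = (\<Sum>k\<in>UNIV. if k = i then A $ i $ i * B $ i $ i else 0)"
    by (intro sum.cong refl)
  then show "(A ** B) $ i $ i = A $ i $ i * B $ i $ i"
    by (simp add: matrix_matrix_mult_def)
qed

text \<open>Along row \<open>i\<close>, once the entries left of column \<open>j\<close> vanish, the
  entry \<open>(i, j)\<close> of the product \<open>B ** A\<close> is just
  \<open>B $ i $ j * A $ j $ j\<close>, whose second factor is nonzero because the determinant
  is.\<close>

lemma upper_triangular_inverse:
  fixes A B :: "real^'n::{finite,wellorder}^'n::{finite,wellorder}"
  assumes "upper_triangular A" "B ** A = mat 1"
  shows "upper_triangular B"
proof -
  have A: "A $ i $ j = 0" if "j < i" for i j
    using assms that by (auto simp: upper_triangular_def)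
  have "det B * det A = 1"
    by (metis assms(2) det_I det_mul)
  moreover have "det A = (\<Prod>i\<in>UNIV. A $ i $ i)"
    by (rule det_upperdiagonal) (rule A)
  ultimately have "(\<Prod>i\<in>UNIV. A $ i $ i) \<noteq> 0"
    by (metis mult_zero_right zero_neq_one)
  then have nz: "A $ i $ i \<noteq> 0" for i
    by simp
  have "B $ i $ j = 0" if "j < i" for i j
    using that
  proof (induction j rule: less_induct)
    case (less j)
    have "B $ i $ k * A $ k $ j = (if k = j then B $ i $ j * A $ j $ j else 0)" for k
      using less A[of j k] by (cases k j rule: linorder_cases) auto
    then have "(\<Sum>k\<in>UNIV. B $ i $ k * A $ k $ j) = (\<Sum>k\<in>UNIV. if k = j then B $ i $ j * A $ j $ j else 0)"
      by (intro sum.cong refl)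
    then have "(B ** A) $ i $ j = B $ i $ j * A $ j $ j"
      by (simp add: matrix_matrix_mult_def)
    then show ?case
      using assms(2) nz[of j] less.prems by (auto simp: mat_def split: if_splits)
  qed
  then show ?thesis
    by (simp add: upper_triangular_def)
qed

lemma pos_upper_mult: "pos_upper A \<Longrightarrow> pos_upper B \<Longrightarrow> pos_upper (A ** B)"
  by (simp add: pos_upper_def upper_triangular_mult)

lemma pos_upper_det:
  fixes r :: "real^'n::{finite,wellorder}^'n::{finite,wellorder}"
  assumes "pos_upper r"
  shows "det r > 0"
proof -
  have "det r = (\<Prod>i\<in>UNIV. r $ i $ i)"
    using assms by (intro det_upperdiagonal) (simp add: pos_upper_def upper_triangular_def)
  then show ?thesis
    using assms by (simp add: pos_upper_def prod_pos)
qed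

lemma pos_upper_inverse:
  fixes r :: "real^'n::{finite,wellorder}^'n::{finite,wellorder}"
  assumes "pos_upper r"
  obtains s where "pos_upper s" "r ** s = mat 1" "s ** r = mat 1"
proof -
  obtain s where s: "r ** s = mat 1" "s ** r = mat 1"
    using pos_upper_det[OF assms] invertible_det_nz[of r] unfolding invertible_def by auto
  have up: "upper_triangular s"
    using upper_triangular_inverse[OF _ s(2)] assms by (simp add: pos_upper_def)
  have "r $ i $ i * s $ i $ i = 1" for i
    using upper_triangular_mult(2)[of r s i] assms up s(1) by (simp add: pos_upper_def mat_def)
  then have "s $ i $ i > 0" for i
    using assms by (metis pos_upper_def zero_less_mult_pos zero_less_one)
  with up have "pos_upper s"
    by (simp add: pos_upper_def)
  then show thesis
    using s by (rule that)
qed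

text \<open>The transpose is the inverse and hence upper triangular too, so \<open>t\<close> is
  diagonal, with positive entries of square 1.\<close>

lemma orthogonal_pos_upper_eq_one:
  fixes t :: "real^'n::{finite,wellorder}^'n::{finite,wellorder}"
  assumes "orthogonal_matrix t" "pos_upper t"
  shows "t = mat 1"
proof -
  have t: "transpose t ** t = mat 1"
    using assms(1) by (simp add: orthogonal_matrix)
  have up: "upper_triangular t" "upper_triangular (transpose t)"
    using assms(2) upper_triangular_inverse[OF _ t] by (auto simp: pos_upper_def)
  have "t $ i $ i = 1" for i
  proof -
    have "t $ i $ i * t $ i $ i = 1"
      using upper_triangular_mult(2)[OF up(2) up(1), of i] t by (simp add: transpose_def mat_def)
    then show ?thesis
      using assms(2) by (smt (verit) pos_upper_def square_eq_1_iff)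
  qed
  moreover have "t $ i $ j = 0" if "i \<noteq> j" for i j
    using up that unfolding upper_triangular_def transpose_def by (metis neqE vec_lambda_beta)
  ultimately show ?thesis
    by (simp add: vec_eq_iff mat_def)
qed

text \<open>Two such factorizations differ by a matrix that is orthogonal and upper triangular with
  positive diagonal, hence by the identity. This evaluates the definite description in the
  definition.\<close>

lemma gram_schmidt_factor_eq:
  fixes q :: "real^'n::{finite,wellorder}^'n::{finite,wellorder}"
  assumes "rotation_matrix q" "pos_upper r"
  shows "gram_schmidt_factor (q ** r) = q"
  unfolding gram_schmidt_factor_def
proof (rule the_equality)
  show "rotation_matrix q \<and> (\<exists>s. upper_triangular s \<and> (\<forall>i. s $ i $ i > 0) \<and> q ** r = q ** s)"
    using assms by (auto simp: pos_upper_def)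
next
  fix q' assume "rotation_matrix q' \<and> (\<exists>s. upper_triangular s \<and> (\<forall>i. s $ i $ i > 0) \<and> q ** r = q' ** s)"
  then obtain r' where r': "rotation_matrix q'" "pos_upper r'" "q ** r = q' ** r'"
    by (auto simp: pos_upper_def)
  obtain s where s: "pos_upper s" "r ** s = mat 1"
    using pos_upper_inverse[OF assms(2)] by metis
  have orth: "transpose q' ** q' = mat 1" "q' ** transpose q' = mat 1"
    using r'(1) by (auto simp: rotation_matrix_def orthogonal_matrix_def)
  have "q = q ** (r ** s)"
    by (simp add: s)
  also have "\<dots> = q' ** (r' ** s)"
    by (simp add: matrix_mul_assoc r'(3))
  finally have q: "q = q' ** (r' ** s)" .
  have "transpose q' ** q = (transpose q' ** q') ** (r' ** s)"
    by (subst q) (simp only: matrix_mul_assoc)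
  then have eq: "transpose q' ** q = r' ** s"
    by (simp add: orth)
  have "orthogonal_matrix (transpose q' ** q)"
    using assms(1) r'(1) by (intro orthogonal_matrix_mul) (auto simp: rotation_matrix_def orthogonal_matrix_transpose)
  then have "r' ** s = mat 1"
    using orthogonal_pos_upper_eq_one pos_upper_mult[OF r'(2) s(1)] eq by simp
  then show "q' = q"
    using q by simp
qed

text \<open>The inverse of \<open>u'\<close> times \<open>u\<close> equals \<open>l'\<close> times
  the inverse of \<open>l\<close>; this matrix is both upper triangular and unit lower
  triangular.\<close>

lemma UL_factorization_unique:
  fixes A :: "real^'n::{finite,wellorder}^'n::{finite,wellorder}"
  assumes "is_UL_factorization A u l" "is_UL_factorization A u' l'"
  shows "l = l'"
proof -
  obtain t where t: "t ** u' = mat 1"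
    using assms(2) by (auto simp: is_UL_factorization_def invertible_def)
  obtain m where m: "m \<in> unit_lower" "l ** m = mat 1" "m ** l = mat 1"
    using assms(1) unit_lower_inverse[of l] by (metis is_UL_factorization_def)
  have eq: "u ** l = u' ** l'"
    using assms by (simp add: is_UL_factorization_def)
  have "t ** u = t ** (u ** l) ** m"
    by (simp add: matrix_mul_assoc[symmetric] m)
  also have "\<dots> = (t ** u') ** l' ** m"
    by (simp add: eq matrix_mul_assoc)
  finally have tu: "t ** u = l' ** m"
    by (simp add: t)
  have "upper_triangular (t ** u)"
    using assms upper_triangular_inverse[OF _ t]
    by (auto simp: is_UL_factorization_def intro: upper_triangular_mult)
  moreover have "l' ** m \<in> unit_lower"
    using assms(2) m(1) by (auto simp: is_UL_factorization_def intro: unit_lower_mult)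
  ultimately have "l' ** m = mat 1"
    unfolding tu vec_eq_iff mat_def unit_lower_def lower_triangular_def upper_triangular_def
    by simp (metis linorder_neqE)
  then have "l' ** (m ** l) = l"
    by (simp add: matrix_mul_assoc)
  then show ?thesis
    by (simp add: m)
qed

text \<open>A certificate for the value of \<open>Phi\<close> that carries both factorizations. A
  positive diagonal is demanded of \<open>u\<close>, beyond invertibility, because under
  transposition \<open>u\<close> takes over the role of \<open>r\<close>.\<close>

definition rotated_UL ::
    "('n::{finite,wellorder} \<Rightarrow> 'n) \<Rightarrow> real^'n::{finite,wellorder}^'n::{finite,wellorder} \<Rightarrow> real^'n::{finite,wellorder}^'n::{finite,wellorder} \<Rightarrow> bool" where
  "rotated_UL p l l' \<longleftrightarrow> l \<in> unit_lower \<and> l' \<in> unit_lower \<and>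
     (\<exists>q r u. rotation_matrix q \<and> pos_upper r \<and> l = q ** r \<and> pos_upper u \<and> permute_conj p q = u ** l')"

lemma rotated_UL_Phi:
  assumes "bij p" "rotated_UL p l l'"
  shows "Phi (perm_matrix p) l = Some l'"
proof -
  obtain q r u where q: "l \<in> unit_lower" "l' \<in> unit_lower" "rotation_matrix q" "pos_upper r"
      "l = q ** r" "pos_upper u" "permute_conj p q = u ** l'"
    using assms(2) by (auto simp: rotated_UL_def)
  have A: "perm_matrix p ** gram_schmidt_factor l ** matrix_inv (perm_matrix p) = permute_conj p q"
    by (simp add: q(5) gram_schmidt_factor_eq[OF q(3,4)] perm_matrix_conj[OF assms(1)])
  have UL: "is_UL_factorization (permute_conj p q) u l'"
    using q pos_upper_det[OF q(6)]
    by (simp add: is_UL_factorization_def pos_upper_def invertible_det_nz)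
  then have "(THE l'. \<exists>u. is_UL_factorization (permute_conj p q) u l') = l'"
    by (intro the_equality) (use UL_factorization_unique in blast)+
  then show ?thesis
    unfolding Phi_def A Let_def using UL q(1) by auto
qed

text \<open>Transposing both factorizations \<open>l = q r\<close> and \<open>\<sigma> q \<sigma>\<^sup>-\<^sup>1 = u l'\<close> exchanges their roles.\<close>

lemma rotated_UL_inverse:
  assumes p: "bij p" and ll: "rotated_UL p l l'"
    and m: "m \<in> unit_lower" "l ** m = mat 1" and m': "m' \<in> unit_lower" "l' ** m' = mat 1"
  shows "rotated_UL (perm_inv p) m' m"
proof -
  obtain q r u where q: "rotation_matrix q" "pos_upper r"
      "l = q ** r" "pos_upper u" "permute_conj p q = u ** l'"
    using ll by (auto simp: rotated_UL_def)
  let ?q = "permute_conj p q"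
  have rot: "rotation_matrix ?q"
    by (rule rotation_matrix_permute_conj[OF p q(1)])
  have "?q ** m' = u ** (l' ** m')"
    by (simp only: q(5) matrix_mul_assoc)
  then have u: "u = ?q ** m'"
    by (simp add: m')
  have "transpose ?q ** u = (transpose ?q ** ?q) ** m'"
    by (simp only: u matrix_mul_assoc)
  \<comment> \<open>This is the Gram-Schmidt factorization of \<open>m'\<close>, with rotation
    \<open>transpose ?q\<close>.\<close>
  then have 1: "m' = transpose ?q ** u"
    using rot by (simp add: rotation_matrix_def orthogonal_matrix)
  have "transpose q ** (q ** r) ** m = (transpose q ** q) ** r ** m"
    by (simp only: matrix_mul_assoc)
  also have "\<dots> = r ** m"
    using q(1) by (simp add: rotation_matrix_def orthogonal_matrix)
  also have "transpose q ** (q ** r) ** m = transpose q ** (l ** m)"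
    by (simp only: q(3) matrix_mul_assoc)
  finally have "transpose q = r ** m"
    by (simp add: m)
  \<comment> \<open>Conjugating that rotation back gives \<open>transpose q\<close>, whose UL
    factorization has lower factor \<open>m\<close>.\<close>
  then have 2: "permute_conj (perm_inv p) (transpose ?q) = r ** m"
    by (simp add: permute_conj_transpose permute_conj_inv[OF p])
  have "rotation_matrix (transpose ?q)"
    using rot by (simp add: rotation_matrix_def orthogonal_matrix_transpose det_transpose)
  with 1 2 q(2,4) m(1) m'(1) show ?thesis
    unfolding rotated_UL_def by blast
qed

section \<open>The Gram-Schmidt factorization\<close>

text \<open>The vectors are left unnormalized, so the recursion is rational in the entries; square
  roots enter only in \<open>QR_factorization\<close>, through the squared lengths
  \<open>gs_norm\<close>.\<close>

function gram_schmidt :: "real^'n::{finite,wellorder}^'n::{finite,wellorder} \<Rightarrow> 'n \<Rightarrow> real^'n::{finite,wellorder}" where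
  "gram_schmidt A j = column j A -
     (\<Sum>k\<in>{..<j}. (gram_schmidt A k \<bullet> column j A / (gram_schmidt A k \<bullet> gram_schmidt A k)) *\<^sub>R gram_schmidt A k)"
  by pat_completeness auto
termination
  by (relation "inv_image {(x, y). x < y} snd") (auto intro: wf_inv_image wf)

declare gram_schmidt.simps [simp del]

definition gs_norm :: "real^'n::{finite,wellorder}^'n::{finite,wellorder} \<Rightarrow> 'n \<Rightarrow> real" where
  "gs_norm A j = gram_schmidt A j \<bullet> gram_schmidt A j"

definition gs_coeff :: "real^'n::{finite,wellorder}^'n::{finite,wellorder} \<Rightarrow> real^'n::{finite,wellorder}^'n::{finite,wellorder}" where
  "gs_coeff A = (\<chi> i j. if i = j then 1 else if i < j then gram_schmidt A i \<bullet> column j A / gs_norm A i else 0)"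

lemma gram_schmidt_orthogonal:
  assumes "k < j"
  shows "gram_schmidt A k \<bullet> gram_schmidt A j = 0"
  using assms
proof (induction j arbitrary: k rule: less_induct)
  case (less j)
  let ?v = "gram_schmidt A" and ?c = "column j A"
  have orth: "?v k \<bullet> ?v m = 0" if "m < j" "m \<noteq> k" for m
    using less.IH[of m k] less.IH[of k m] less.prems that
    by (cases m k rule: linorder_cases) (auto simp: inner_commute)
  \<comment> \<open>If \<open>?v k\<close> is zero the quotient is 0 by convention, and both sides
    of the term \<open>m = k\<close> vanish.\<close>
  have "(\<Sum>m\<in>{..<j}. (?v m \<bullet> ?c / (?v m \<bullet> ?v m)) * (?v k \<bullet> ?v m))
      = (\<Sum>m\<in>{..<j}. if m = k then ?v k \<bullet> ?c else 0)"
    by (rule sum.cong) (auto simp: orth)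
  then have "(\<Sum>m\<in>{..<j}. (?v m \<bullet> ?c / (?v m \<bullet> ?v m)) * (?v k \<bullet> ?v m)) = ?v k \<bullet> ?c"
    using less.prems by simp
  then show ?case
    by (subst gram_schmidt.simps[of A j]) (simp add: inner_diff_right inner_sum_right)
qed

lemma gram_schmidt_mult_coeff:
  "(\<chi> i j. gram_schmidt A j $ i) ** gs_coeff A = A"
proof -
  have "(\<Sum>k\<in>UNIV. gram_schmidt A k $ i * gs_coeff A $ k $ j) = A $ i $ j" for i j
  proof -
    let ?f = "\<lambda>k. gram_schmidt A k $ i * gs_coeff A $ k $ j"
    have "(\<Sum>k\<in>UNIV. ?f k) = (\<Sum>k\<in>insert j {..<j}. ?f k)"
      by (rule sum.mono_neutral_right) (auto simp: gs_coeff_def)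
    also have "\<dots> = gram_schmidt A j $ i + (\<Sum>k\<in>{..<j}. ?f k)"
      by (simp add: gs_coeff_def)
    also have "(\<Sum>k\<in>{..<j}. ?f k) = (\<Sum>k\<in>{..<j}. (gram_schmidt A k \<bullet> column j A /
        (gram_schmidt A k \<bullet> gram_schmidt A k)) *\<^sub>R gram_schmidt A k) $ i"
      by (auto simp: gs_coeff_def gs_norm_def sum_component intro!: sum.cong)
    also have "gram_schmidt A j $ i + \<dots> = A $ i $ j"
      by (subst gram_schmidt.simps[of A j]) (simp add: column_def)
    finally show ?thesis .
  qed
  then show ?thesis
    by (simp add: vec_eq_iff matrix_matrix_mult_def)
qed

text \<open>The orthogonal vectors are the columns of a left factor of \<open>A\<close>, and a zero
  column would force \<open>det A = 0\<close>.\<close>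

lemma gs_norm_pos:
  assumes "det A \<noteq> 0"
  shows "gs_norm A j > 0"
proof -
  have "det (\<chi> i j. gram_schmidt A j $ i) \<noteq> 0"
    using assms gram_schmidt_mult_coeff[of A] by (metis det_mul mult_zero_left)
  moreover have "det (\<chi> i j. gram_schmidt A j $ i) = 0" if "gram_schmidt A j = 0"
    using that by (intro det_zero_column(1)[of j]) (simp add: column_def vec_eq_iff)
  ultimately show ?thesis
    by (auto simp: gs_norm_def)
qed

lemma QR_factorization:
  fixes A :: "real^'n::{finite,wellorder}^'n::{finite,wellorder}"
  assumes "det A > 0"
  defines "q \<equiv> \<chi> i j. gram_schmidt A j $ i / sqrt (gs_norm A j)"
    and "r \<equiv> \<chi> i j. sqrt (gs_norm A i) * gs_coeff A $ i $ j"
  shows "rotation_matrix q" "pos_upper r" "A = q ** r"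
proof -
  have D: "gs_norm A j > 0" for j
    using assms(1) by (intro gs_norm_pos) simp
  show r: "pos_upper r"
    using D by (auto simp: pos_upper_def upper_triangular_def r_def gs_coeff_def)
  have "q ** r = (\<chi> i j. gram_schmidt A j $ i) ** gs_coeff A"
    using less_imp_neq[OF D] by (simp add: q_def r_def matrix_matrix_mult_def)
  then show A: "A = q ** r"
    by (simp add: gram_schmidt_mult_coeff)
  have "(\<Sum>k\<in>UNIV. q $ k $ i * q $ k $ j) = (if i = j then 1 else 0)" for i j
  proof -
    have "(\<Sum>k\<in>UNIV. q $ k $ i * q $ k $ j)
        = gram_schmidt A i \<bullet> gram_schmidt A j / (sqrt (gs_norm A i) * sqrt (gs_norm A j))"
      by (simp add: q_def inner_vec_def sum_divide_distrib)
    then show ?thesis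
      using D[of i] gram_schmidt_orthogonal[of i j A] gram_schmidt_orthogonal[of j i A]
      by (cases i j rule: linorder_cases) (auto simp: gs_norm_def inner_commute)
  qed
  then have orth: "orthogonal_matrix q"
    by (simp add: orthogonal_matrix vec_eq_iff matrix_matrix_mult_def transpose_def mat_def)
  \<comment> \<open>The positive determinants of \<open>A\<close> and \<open>r\<close> exclude the
    value -1 for the orthogonal matrix \<open>q\<close>.\<close>
  have "det q > 0"
    using assms(1) pos_upper_det[OF r] by (simp add: A det_mul zero_less_mult_iff)
  then have "det q = 1"
    using det_orthogonal_matrix[OF orth] by auto
  with orth show "rotation_matrix q"
    by (simp add: rotation_matrix_def)
qed

section \<open>Splitting a unit lower triangular matrix along a permutation\<close>

text \<open>The common values of the two factors of \<open>n = n1 n2\<close>, where the off-diagonal entries \<open>(i, j)\<close>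
  of \<open>n1\<close> and \<open>n2\<close> live on the inversions and noninversions of \<open>p\<close>, respectively. Solving
  \<open>n = n1 n2\<close> for the entry \<open>(i, j)\<close> gives the recursion.\<close>

function split_entry :: "('n::{finite,wellorder} \<Rightarrow> 'n) \<Rightarrow> real^'n::{finite,wellorder}^'n::{finite,wellorder} \<Rightarrow> 'n \<Rightarrow> 'n \<Rightarrow> real" where
  "split_entry p n i j = n $ i $ j -
     (\<Sum>k\<in>{k. j < k \<and> k < i \<and> p i < p k \<and> p j < p k}. split_entry p n i k * split_entry p n k j)"
  by pat_completeness auto
termination
  by (relation "Wellfounded.measure (\<lambda>(p, n, i, j). card {j<..<i})") (auto intro!: psubset_card_mono)

declare split_entry.simps [simp del]

definition inversion_part :: "('n::{finite,wellorder} \<Rightarrow> 'n) \<Rightarrow> real^'n::{finite,wellorder}^'n::{finite,wellorder} \<Rightarrow> real^'n::{finite,wellorder}^'n::{finite,wellorder}" where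
  "inversion_part p n = (\<chi> i j. if i = j then 1 else if j < i \<and> p i < p j then split_entry p n i j else 0)"

definition noninversion_part :: "('n::{finite,wellorder} \<Rightarrow> 'n) \<Rightarrow> real^'n::{finite,wellorder}^'n::{finite,wellorder} \<Rightarrow> real^'n::{finite,wellorder}^'n::{finite,wellorder}" where
  "noninversion_part p n = (\<chi> i j. if i = j then 1 else if j < i \<and> p j < p i then split_entry p n i j else 0)"

text \<open>Below the diagonal, the intermediate indices strictly between \<open>j\<close> and
  \<open>i\<close> contribute exactly the sum of the recursion. Of the two remaining ones,
  \<open>i\<close> and \<open>j\<close>, exactly one contributes \<open>split_entry p n i j\<close>,
  as \<open>p\<close> is injective.\<close>

lemma inversion_part_mult_noninversion_part:
  fixes n :: "real^'n::{finite,wellorder}^'n::{finite,wellorder}"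
  assumes p: "bij p" and n: "n \<in> unit_lower"
  shows "inversion_part p n ** noninversion_part p n = n"
proof -
  let ?a = "inversion_part p n" and ?b = "noninversion_part p n"
  have "(\<Sum>k\<in>UNIV. ?a $ i $ k * ?b $ k $ j) = n $ i $ j" for i j
  proof (cases i j rule: linorder_cases)
    case less
    then have "?a $ i $ k * ?b $ k $ j = 0" for k
      by (auto simp: inversion_part_def noninversion_part_def)
    then have "(\<Sum>k\<in>UNIV. ?a $ i $ k * ?b $ k $ j) = 0"
      by (intro sum.neutral) blast
    then show ?thesis
      using less n by (simp add: unit_lower_def lower_triangular_def)
  next
    case equal
    then have "?a $ i $ k * ?b $ k $ j = (if k = i then 1 else 0)" for k
      by (auto simp: inversion_part_def noninversion_part_def)
    then show ?thesis
      using equal n by (simp add: unit_lower_def)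
  next
    case greater
    let ?f = "\<lambda>k. ?a $ i $ k * ?b $ k $ j"
    let ?K = "{k. j < k \<and> k < i \<and> p i < p k \<and> p j < p k}"
    have "(\<Sum>k\<in>UNIV. ?f k) = (\<Sum>k\<in>insert i (insert j ?K). ?f k)"
      by (rule sum.mono_neutral_right) (auto simp: inversion_part_def noninversion_part_def)
    also have "\<dots> = ?f i + (?f j + (\<Sum>k\<in>?K. ?f k))"
      using greater by (subst sum.insert; simp)+
    also have "(\<Sum>k\<in>?K. ?f k) = (\<Sum>k\<in>?K. split_entry p n i k * split_entry p n k j)"
      by (rule sum.cong) (auto simp: inversion_part_def noninversion_part_def)
    also have "\<dots> = n $ i $ j - split_entry p n i j"
      by (subst (3) split_entry.simps) simp
    also have "?f j = (if p i < p j then split_entry p n i j else 0)"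
      using greater by (simp add: inversion_part_def noninversion_part_def)
    also have "?f i = (if p j < p i then split_entry p n i j else 0)"
      using greater by (simp add: inversion_part_def noninversion_part_def)
    finally show ?thesis
      using greater bij_is_inj[OF p] by (auto simp: inj_eq neq_iff)
  qed
  then show ?thesis
    by (simp add: vec_eq_iff matrix_matrix_mult_def)
qed

section \<open>The map as an explicit formula\<close>

text \<open>With \<open>d\<close> the diagonal matrix of the square roots of
  \<open>gs_norm l\<close> and \<open>b\<close> the noninversion part, this is \<open>b\<close>
  conjugated by the inverse of \<open>d\<close>: moving \<open>d\<close> to the left past
  \<open>b\<close> restores a unit diagonal on the right.\<close>

definition rotated_UL_preimage :: "('n::{finite,wellorder} \<Rightarrow> 'n) \<Rightarrow> real^'n::{finite,wellorder}^'n::{finite,wellorder} \<Rightarrow> real^'n::{finite,wellorder}^'n::{finite,wellorder}" where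
  "rotated_UL_preimage p l = (\<chi> i j. noninversion_part p (transpose (gs_coeff l)) $ i $ j *
     sqrt (gs_norm l j) / sqrt (gs_norm l i))"

definition rotated_UL_map :: "('n::{finite,wellorder} \<Rightarrow> 'n) \<Rightarrow> real^'n::{finite,wellorder}^'n::{finite,wellorder} \<Rightarrow> real^'n::{finite,wellorder}^'n::{finite,wellorder}" where
  "rotated_UL_map p l = permute_conj p (rotated_UL_preimage p l)"

lemma det_unit_lower:
  assumes "A \<in> unit_lower"
  shows "det A = 1"
  using det_lowerdiagonal[of A] assms by (simp add: unit_lower_def lower_triangular_def)

lemma rotated_UL_map:
  fixes l :: "real^'n::{finite,wellorder}^'n::{finite,wellorder}"
  assumes p: "bij p" and l: "l \<in> unit_lower" and pl: "permute_conj p l \<in> unit_lower"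
  shows "rotated_UL p l (rotated_UL_map p l)"
    and "permute_conj (perm_inv p) (rotated_UL_map p l) \<in> unit_lower"
proof -
  define q where "q = (\<chi> i j. gram_schmidt l j $ i / sqrt (gs_norm l j))"
  define r where "r = (\<chi> i j. sqrt (gs_norm l i) * gs_coeff l $ i $ j)"
  define n where "n = transpose (gs_coeff l)"
  \<comment> \<open>This \<open>n1\<close> absorbs the diagonal factor that the overview writes
    separately as \<open>d\<close>.\<close>
  define n1 where "n1 = (\<chi> i j. inversion_part p n $ i $ j * sqrt (gs_norm l j))"
  define n2 where "n2 = rotated_UL_preimage p l"
  have det: "det l > 0"
    by (simp add: det_unit_lower[OF l])
  note qr = QR_factorization[OF det, folded q_def r_def]
  have D: "gs_norm l j > 0" for j
    using det by (intro gs_norm_pos) simp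
  have n: "n \<in> unit_lower"
    by (auto simp: n_def unit_lower_def lower_triangular_def transpose_def gs_coeff_def)
  have n2': "n2 $ i $ j = noninversion_part p n $ i $ j * sqrt (gs_norm l j) / sqrt (gs_norm l i)" for i j
    by (simp add: n2_def rotated_UL_preimage_def n_def)
  have "n1 $ i $ k * n2 $ k $ j
      = (inversion_part p n $ i $ k * noninversion_part p n $ k $ j) * sqrt (gs_norm l j)" for i j k
    using D[of k] by (simp add: n1_def n2')
  then have "(n1 ** n2) $ i $ j = (inversion_part p n ** noninversion_part p n) $ i $ j * sqrt (gs_norm l j)" for i j
    by (simp add: matrix_matrix_mult_def sum_distrib_right)
  then have "(n1 ** n2) $ i $ j = n $ i $ j * sqrt (gs_norm l j)" for i j
    by (simp only: inversion_part_mult_noninversion_part[OF p n])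
  then have rT: "transpose r = n1 ** n2"
    by (simp add: vec_eq_iff r_def n_def transpose_def mult.commute)
  obtain m where m: "m \<in> unit_lower" "l ** m = mat 1" "m ** l = mat 1"
    using unit_lower_inverse[OF l] by metis
  have pm: "permute_conj p m \<in> unit_lower"
    by (rule permute_conj_inverse_unit_lower[OF p pl m(2)])
  \<comment> \<open>Since \<open>q ** r ** m\<close> is the identity, so is its transpose; solving
    for \<open>q\<close> with the help of orthogonality gives \<open>q\<close> as the product of the
    transposes of \<open>m\<close> and \<open>r\<close>.\<close>
  have "transpose m ** transpose r = transpose m ** (transpose r ** (transpose q ** q))"
    using qr(1) by (simp add: rotation_matrix_def orthogonal_matrix)
  also have "\<dots> = transpose (q ** r ** m) ** q"
    by (simp only: matrix_transpose_mul matrix_mul_assoc)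
  also have "\<dots> = q"
    by (simp add: qr(3)[symmetric] m transpose_mat)
  finally have q: "q = transpose m ** (n1 ** n2)"
    by (simp add: rT)
  let ?u = "transpose (permute_conj p m) ** permute_conj p n1"
  have "permute_conj p q = ?u ** rotated_UL_map p l"
    by (subst q)
       (simp add: permute_conj_mult[OF p] permute_conj_transpose rotated_UL_map_def n2_def matrix_mul_assoc)
  moreover have "pos_upper ?u"
  proof (rule pos_upper_mult)
    show "pos_upper (transpose (permute_conj p m))"
      using pm by (simp add: pos_upper_def upper_triangular_def transpose_def unit_lower_def lower_triangular_def)
    \<comment> \<open>Entry \<open>(i, j)\<close> of the conjugate sits at
      \<open>(perm_inv p i, perm_inv p j)\<close> in \<open>n1\<close>, so the inversion condition
      there becomes \<open>i < j\<close>.\<close>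
    have "p (perm_inv p i) = i" for i
      using p by (simp add: bij_is_surj surj_f_inv_f)
    moreover have "perm_inv p i = perm_inv p j \<longleftrightarrow> i = j" for i j
      using p by (simp add: bij_imp_bij_inv bij_is_inj inj_eq)
    ultimately show "pos_upper (permute_conj p n1)"
      using D by (auto simp: pos_upper_def upper_triangular_def permute_conj_def n1_def inversion_part_def)
  qed
  moreover have "rotated_UL_map p l \<in> unit_lower"
  proof -
    \<comment> \<open>Likewise the noninversion condition becomes \<open>j < i\<close>.\<close>
    have "p (perm_inv p i) = i" for i
      using p by (simp add: bij_is_surj surj_f_inv_f)
    moreover have "perm_inv p i = perm_inv p j \<longleftrightarrow> i = j" for i j
      using p by (simp add: bij_imp_bij_inv bij_is_inj inj_eq)
    ultimately show ?thesis
      using less_imp_neq[OF D]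
      by (auto simp: rotated_UL_map_def n2_def[symmetric] n2' unit_lower_def lower_triangular_def
          permute_conj_def noninversion_part_def)
  qed
  ultimately show "rotated_UL p l (rotated_UL_map p l)"
    unfolding rotated_UL_def using l qr by blast
  have "n2 \<in> unit_lower"
    using less_imp_neq[OF D]
    by (auto simp: n2' unit_lower_def lower_triangular_def noninversion_part_def)
  then show "permute_conj (perm_inv p) (rotated_UL_map p l) \<in> unit_lower"
    by (simp add: rotated_UL_map_def permute_conj_inv[OF p] n2_def)
qed

section \<open>Analyticity of the formula\<close>

lemma analytic_germ_if:
  "(c \<Longrightarrow> analytic_germ f a) \<Longrightarrow> (\<not> c \<Longrightarrow> analytic_germ g a) \<Longrightarrow>
    analytic_germ (\<lambda>x. if c then f x else g x) a"
  by (cases c) simp_all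

lemma analytic_germ_entry: "analytic_germ (\<lambda>X :: real^'n^'m. X $ i $ j) a"
proof -
  have "axis i (axis j 1) \<in> (Basis :: (real^'n^'m) set)"
    by (simp add: axis_in_Basis_iff)
  from analytic_germ_coordinate[OF this, of a] show ?thesis
    by (simp add: inner_axis)
qed

lemma analytic_germ_matrix_inner:
  fixes g :: "'a::euclidean_space \<Rightarrow> real^'n^'m"
  assumes "\<And>i j. analytic_germ (\<lambda>x. g x $ i $ j) a" "b \<in> Basis"
  shows "analytic_germ (\<lambda>x. g x \<bullet> b) a"
proof -
  obtain i j where "b = axis i (axis j 1)"
    using assms(2) by (auto simp: Basis_vec_def)
  then show ?thesis
    using assms(1)[of i j] by (simp add: inner_axis)
qed

lemma analytic_germ_det:
  fixes X :: "'a::euclidean_space \<Rightarrow> real^'n^'n"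
  assumes "\<And>i j. analytic_germ (\<lambda>x. X x $ i $ j) a"
  shows "analytic_germ (\<lambda>x. det (X x)) a"
  unfolding det_def by (intro analytic_germ_sum analytic_germ_mult analytic_germ_prod analytic_germ_const assms)

text \<open>Quotients of determinants express the inverse by a formula in the entries, which makes
  its analyticity visible.\<close>

definition cramer_inverse :: "real^'n^'n \<Rightarrow> real^'n^'n" where
  "cramer_inverse A = (\<chi> k m. det (\<chi> i j. if j = k then mat 1 $ i $ m else A $ i $ j) / det A)"

lemma cramer_inverse:
  assumes "det A \<noteq> 0"
  shows "A ** cramer_inverse A = mat 1"
proof -
  have "A *v column m (cramer_inverse A) = column m (mat 1)" for m
    unfolding cramer[OF assms] cramer_inverse_def column_def by (simp cong del: if_weak_cong)
  then have "column m (A ** cramer_inverse A) = column m (mat 1)" for m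
    by (simp add: matrix_vector_mult_def matrix_matrix_mult_def column_def)
  then show ?thesis
    by (simp add: vec_eq_iff column_def)
qed

lemma analytic_germ_cramer_inverse:
  fixes X :: "'a::euclidean_space \<Rightarrow> real^'n^'n"
  assumes "\<And>i j. analytic_germ (\<lambda>x. X x $ i $ j) a" "det (X a) > 0"
  shows "analytic_germ (\<lambda>x. cramer_inverse (X x) $ i $ j) a"
proof -
  have "analytic_germ (\<lambda>x. (\<chi> i' j'. if j' = i then mat 1 $ i' $ j else X x $ i' $ j') $ i' $ j') a" for i' j'
    using assms(1) by (auto intro!: analytic_germ_if)
  then show ?thesis
    unfolding cramer_inverse_def using assms
    by (simp add: analytic_germ_divide analytic_germ_det)
qed

lemma analytic_germ_inner:
  fixes f g :: "'a::euclidean_space \<Rightarrow> real^'n"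
  assumes "\<And>i. analytic_germ (\<lambda>x. f x $ i) a" "\<And>i. analytic_germ (\<lambda>x. g x $ i) a"
  shows "analytic_germ (\<lambda>x. f x \<bullet> g x) a"
  unfolding inner_vec_def inner_real_def by (intro analytic_germ_sum analytic_germ_mult assms)

text \<open>The recursion is followed column by column. A germ may be divided by one that is
  positive at the centre, so it suffices that the squared lengths are positive at
  \<open>a\<close>.\<close>

lemma analytic_germ_gram_schmidt:
  fixes X :: "'a::euclidean_space \<Rightarrow> real^'n::{finite,wellorder}^'n::{finite,wellorder}"
  assumes X: "\<And>i j. analytic_germ (\<lambda>x. X x $ i $ j) a" and det: "det (X a) \<noteq> 0"
  shows "analytic_germ (\<lambda>x. gram_schmidt (X x) j $ i) a"
proof (induction j arbitrary: i rule: less_induct)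
  case (less j)
  have "analytic_germ (\<lambda>x. X x $ i $ j - (\<Sum>k\<in>{..<j}. (gram_schmidt (X x) k \<bullet> column j (X x) /
      (gram_schmidt (X x) k \<bullet> gram_schmidt (X x) k)) * gram_schmidt (X x) k $ i)) a"
    by (intro analytic_germ_diff analytic_germ_sum analytic_germ_mult analytic_germ_divide analytic_germ_inner X)
       (use less.IH X gs_norm_pos[OF det] in \<open>auto simp: column_def gs_norm_def\<close>)
  then show ?case
    by (subst gram_schmidt.simps) (simp add: column_def)
qed

lemma analytic_germ_split_entry:
  fixes X :: "'a::euclidean_space \<Rightarrow> real^'n::{finite,wellorder}^'n::{finite,wellorder}"
  assumes X: "\<And>i j. analytic_germ (\<lambda>x. X x $ i $ j) a"
  shows "analytic_germ (\<lambda>x. split_entry p (X x) i j) a"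
proof (induction "card {j<..<i}" arbitrary: i j rule: less_induct)
  case less
  have "card {k<..<i} < card {j<..<i}" "card {j<..<k} < card {j<..<i}" if "j < k" "k < i" for k
    using that by (auto intro!: psubset_card_mono)
  then show ?case
    by (subst split_entry.simps)
       (auto intro!: analytic_germ_diff analytic_germ_sum analytic_germ_mult X less)
qed

lemma analytic_germ_rotated_UL_map:
  fixes X :: "'a::euclidean_space \<Rightarrow> real^'n::{finite,wellorder}^'n::{finite,wellorder}"
  assumes X: "\<And>i j. analytic_germ (\<lambda>x. X x $ i $ j) a" and det: "det (X a) \<noteq> 0"
  shows "analytic_germ (\<lambda>x. rotated_UL_map p (X x) $ i $ j) a"
proof -
  note gs = analytic_germ_gram_schmidt[OF X det]
  have norm: "analytic_germ (\<lambda>x. gs_norm (X x) i) a" for i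
    unfolding gs_norm_def by (intro analytic_germ_inner gs)
  note pos = gs_norm_pos[OF det]
  have coeff: "analytic_germ (\<lambda>x. transpose (gs_coeff (X x)) $ i $ j) a" for i j
  proof -
    have "analytic_germ (\<lambda>x. gram_schmidt (X x) j \<bullet> column i (X x) / gs_norm (X x) j) a"
      by (intro analytic_germ_divide analytic_germ_inner gs norm pos) (simp add: column_def X)
    then show ?thesis
      by (auto simp: transpose_def gs_coeff_def intro!: analytic_germ_if)
  qed
  have part: "analytic_germ (\<lambda>x. noninversion_part p (transpose (gs_coeff (X x))) $ i $ j) a" for i j
    using analytic_germ_split_entry[OF coeff, of p] by (auto simp: noninversion_part_def intro!: analytic_germ_if)
  show ?thesis
    unfolding rotated_UL_map_def rotated_UL_preimage_def permute_conj_def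
    using pos by (simp add: analytic_germ_divide analytic_germ_mult analytic_germ_sqrt part norm)
qed

section \<open>The diffeomorphism\<close>

lemma subgroup_unit_lower_sub:
  fixes p :: "'n::{finite,wellorder} \<Rightarrow> 'n"
  assumes "bij p"
  shows "subgroup (unit_lower_sub (perm_matrix p)) unit_lower_group"
proof -
  interpret group "unit_lower_group :: (real^'n::{finite,wellorder}^'n::{finite,wellorder}) monoid"
    by (rule group_unit_lower_group)
  note sub = unit_lower_sub_perm_matrix[OF assms]
  note p' = bij_imp_bij_inv[OF assms]
  show ?thesis
  proof (rule subgroupI)
    show "unit_lower_sub (perm_matrix p) \<subseteq> carrier unit_lower_group"
      by (auto simp: sub unit_lower_group_def)
    have "mat 1 \<in> unit_lower_sub (perm_matrix p)"
      by (simp add: sub unit_lower_one permute_conj_one[OF p'])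
    then show "unit_lower_sub (perm_matrix p) \<noteq> {}" by blast
  next
    fix a assume a: "a \<in> unit_lower_sub (perm_matrix p)"
    then obtain b where b: "b \<in> unit_lower" "a ** b = mat 1" "b ** a = mat 1"
      using unit_lower_inverse[of a] by (auto simp: sub)
    have "b \<in> unit_lower_sub (perm_matrix p)"
      using a b unit_lower_sub_inverse[OF assms a b(1,2)] by simp
    moreover have "m_inv unit_lower_group a = b"
      using a b by (intro inv_equality) (auto simp: sub unit_lower_group_def)
    ultimately show "m_inv unit_lower_group a \<in> unit_lower_sub (perm_matrix p)"
      by simp
  next
    fix a b assume "a \<in> unit_lower_sub (perm_matrix p)" "b \<in> unit_lower_sub (perm_matrix p)"
    then show "a \<otimes>\<^bsub>unit_lower_group\<^esub> b \<in> unit_lower_sub (perm_matrix p)"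
      by (simp add: sub unit_lower_group_def unit_lower_mult permute_conj_mult[OF p'])
  qed
qed

text \<open>Conjugating by the inverse permutation moves the entry \<open>(p i, p j)\<close> to
  \<open>(i, j)\<close>, so the zeros are prescribed at the images under \<open>p\<close> of the
  positions above the diagonal.\<close>

lemma unit_lower_sub_coordinate_subspace:
  fixes p :: "'n::{finite,wellorder} \<Rightarrow> 'n"
  assumes "bij p"
  shows "unit_lower_sub (perm_matrix p) =
    unit_lower \<inter> {A. \<forall>(i, j)\<in>{(p i, p j) |i j. i < j}. A $ i $ j = 0}"
  unfolding unit_lower_sub_perm_matrix[OF assms]
  by (auto simp: unit_lower_def lower_triangular_def permute_conj_def inv_inv_eq[OF assms])


text \<open>On the subgroup the Cramer formula is group inversion, hence an involution of the
  subgroup.\<close>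

lemma cramer_inverse_unit_lower_sub:
  fixes l :: "real^'n::{finite,wellorder}^'n::{finite,wellorder}"
  assumes p: "bij p" and l: "l \<in> unit_lower_sub (perm_matrix p)"
  shows "cramer_inverse l \<in> unit_lower_sub (perm_matrix p)"
    and "cramer_inverse l \<in> unit_lower" "l ** cramer_inverse l = mat 1"
    and "cramer_inverse (cramer_inverse l) = l"
proof -
  have ul: "a \<in> unit_lower \<Longrightarrow> a ** cramer_inverse a = mat 1" for a :: "real^'n::{finite,wellorder}^'n::{finite,wellorder}"
    by (rule cramer_inverse) (simp add: det_unit_lower)
  have lU: "l \<in> unit_lower"
    using l by (simp add: unit_lower_sub_def)
  obtain b where b: "b \<in> unit_lower" "b ** l = mat 1"
    using unit_lower_inverse[OF lU] by metis
  have "b ** (l ** cramer_inverse l) = (b ** l) ** cramer_inverse l"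
    by (rule matrix_mul_assoc)
  then have "b = cramer_inverse l"
    by (simp add: b(2) ul[OF lU])
  with b(1) show U: "cramer_inverse l \<in> unit_lower" by simp
  show inv: "l ** cramer_inverse l = mat 1"
    by (rule ul[OF lU])
  show "cramer_inverse l \<in> unit_lower_sub (perm_matrix p)"
    by (rule unit_lower_sub_inverse[OF p l U inv])
  have "l ** (cramer_inverse l ** cramer_inverse (cramer_inverse l))
      = (l ** cramer_inverse l) ** cramer_inverse (cramer_inverse l)"
    by (rule matrix_mul_assoc)
  then show "cramer_inverse (cramer_inverse l) = l"
    by (simp add: inv ul[OF U])
qed

theorem proposition1:
  fixes \<sigma> :: "real^'n::{finite,wellorder}^'n::{finite,wellorder}"
  assumes "permutation_matrix \<sigma>"
  shows "(subgroup (unit_lower_sub \<sigma>) unit_lower_group \<and>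
          (\<exists>Z :: ('n \<times> 'n) set.
             unit_lower_sub \<sigma> = unit_lower \<inter> {A. \<forall>(i, j)\<in>Z. A $ i $ j = 0})) \<and>
         (unit_lower_sub (matrix_inv \<sigma>) \<subseteq> dom (Phi \<sigma>) \<and>
          real_analytic_diffeomorphism (\<lambda>l. the (Phi \<sigma> l))
            (unit_lower_sub (matrix_inv \<sigma>)) (unit_lower_sub \<sigma>))"
proof -
  obtain p where p: "bij p" and \<sigma>: "\<sigma> = perm_matrix p"
    using assms by (auto simp: permutation_matrix_def perm_matrix_def)
  let ?p' = "perm_inv p"
  have p': "bij ?p'" "perm_inv ?p' = p"
    using p by (simp_all add: bij_imp_bij_inv inv_inv_eq)
  let ?S = "unit_lower_sub (perm_matrix ?p')" and ?T = "unit_lower_sub (perm_matrix p)"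
  let ?F = "\<lambda>l. the (Phi (perm_matrix p) l)"
  \<comment> \<open>The candidate inverse from the overview, written with explicit formulas so that
    it can be expanded in the ambient space.\<close>
  let ?G = "\<lambda>l. cramer_inverse (rotated_UL_map ?p' (cramer_inverse l))"
  have F: "rotated_UL p l (rotated_UL_map p l) \<and> rotated_UL_map p l \<in> unit_lower_sub (perm_matrix p) \<and>
      Phi (perm_matrix p) l = Some (rotated_UL_map p l)"
    if "bij p" "l \<in> unit_lower_sub (perm_matrix (perm_inv p))" for p and l :: "real^'n::{finite,wellorder}^'n::{finite,wellorder}"
  proof -
    have "l \<in> unit_lower" "permute_conj p l \<in> unit_lower"
      using that by (auto simp: unit_lower_sub_perm_matrix bij_imp_bij_inv inv_inv_eq)
    note * = rotated_UL_map[OF that(1) this]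
    moreover have "rotated_UL_map p l \<in> unit_lower"
      using *(1) by (simp add: rotated_UL_def)
    ultimately show ?thesis
      using rotated_UL_Phi[OF that(1) *(1)] by (simp add: unit_lower_sub_perm_matrix[OF that(1)])
  qed
  note inv = cramer_inverse_unit_lower_sub
  \<comment> \<open>Both sides are the value of \<open>Phi\<close> for the inverse permutation at
    the same matrix: one by the explicit formula, the other by transposing the factorizations. The
    permutation is arbitrary because both \<open>p\<close> and its inverse are needed.\<close>
  have cancel: "rotated_UL_map (perm_inv p) (cramer_inverse (rotated_UL_map p l)) = cramer_inverse l"
    if p: "bij p" and l: "l \<in> unit_lower_sub (perm_matrix (perm_inv p))" for p and l :: "real^'n::{finite,wellorder}^'n::{finite,wellorder}"
  proof -
    let ?l' = "rotated_UL_map p l"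
    have p': "bij (perm_inv p)" "perm_inv (perm_inv p) = p"
      using p by (simp_all add: bij_imp_bij_inv inv_inv_eq)
    have l': "?l' \<in> unit_lower_sub (perm_matrix p)"
      using F[OF p l] by blast
    have "rotated_UL (perm_inv p) (cramer_inverse ?l') (cramer_inverse l)"
      by (rule rotated_UL_inverse[OF p conjunct1[OF F[OF p l]] inv(2,3)[OF p'(1) l] inv(2,3)[OF p l']])
    then have "Phi (perm_matrix (perm_inv p)) (cramer_inverse ?l') = Some (cramer_inverse l)"
      by (rule rotated_UL_Phi[OF p'(1)])
    moreover have "Phi (perm_matrix (perm_inv p)) (cramer_inverse ?l')
        = Some (rotated_UL_map (perm_inv p) (cramer_inverse ?l'))"
      using F[OF p'(1), of "cramer_inverse ?l'"] inv(1)[OF p l'] p'(2) by simp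
    ultimately show ?thesis
      by simp
  qed
  have F_eq: "?F l = rotated_UL_map p l" and F_in: "?F l \<in> ?T" if "l \<in> ?S" for l
    using F[OF p that] by auto
  have G_in: "?G t \<in> ?S" if "t \<in> ?T" for t
    using F[OF p'(1), of "cramer_inverse t"] inv(1)[OF p that] inv(1)[OF p'(1)] p'(2) by simp
  have GF: "?G (?F l) = l" if "l \<in> ?S" for l
    using cancel[OF p that] inv(4)[OF p'(1) that] F_eq[OF that] by simp
  \<comment> \<open>Here the cancellation is applied to the inverse permutation and the matrix
    inverse of \<open>t\<close>; the two outer inversions then cancel.\<close>
  have FG: "?F (?G t) = t" if "t \<in> ?T" for t
    using cancel[OF p'(1), of "cramer_inverse t"] inv[OF p that] F_eq[OF G_in[OF that]] p'(2) by simp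
  have bij: "bij_betw ?F ?S ?T"
    by (rule bij_betw_byWitness[where f' = ?G]) (use GF FG F_in G_in in blast)+
  have inv_F: "inv_into ?S ?F t = ?G t" if "t \<in> ?T" for t
    using bij_betw_imp_inj_on[OF bij] G_in[OF that] FG[OF that] by (rule inv_into_f_eq)
  have det: "det l = 1" if "l \<in> unit_lower_sub \<tau>" for l \<tau> :: "real^'n::{finite,wellorder}^'n::{finite,wellorder}"
    using that by (intro det_unit_lower) (simp add: unit_lower_sub_def)
  have "real_analytic_on ?F ?S"
  proof (rule real_analytic_onI[OF _ F_eq])
    fix l :: "real^'n::{finite,wellorder}^'n::{finite,wellorder}" and b :: "real^'n::{finite,wellorder}^'n::{finite,wellorder}" assume "l \<in> ?S" "b \<in> Basis"
    then show "analytic_germ (\<lambda>x. rotated_UL_map p x \<bullet> b) l"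
      by (intro analytic_germ_matrix_inner analytic_germ_rotated_UL_map analytic_germ_entry) (simp_all add: det)
  qed
  moreover have "real_analytic_on (inv_into ?S ?F) ?T"
  proof (rule real_analytic_onI[OF _ inv_F])
    fix t :: "real^'n::{finite,wellorder}^'n::{finite,wellorder}" and b :: "real^'n::{finite,wellorder}^'n::{finite,wellorder}" assume t: "t \<in> ?T" and b: "b \<in> Basis"
    have "cramer_inverse t \<in> unit_lower_sub (perm_matrix (perm_inv ?p'))"
      using inv(1)[OF p t] p'(2) by simp
    \<comment> \<open>The outer Cramer formula is expanded at this point; membership in
      \<open>?S\<close> makes its determinant 1, hence positive.\<close>
    then have "rotated_UL_map ?p' (cramer_inverse t) \<in> ?S"
      using F[OF p'(1)] by blast
    then show "analytic_germ (\<lambda>x. ?G x \<bullet> b) t"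
      using inv(1)[OF p t] t b
      by (intro analytic_germ_matrix_inner analytic_germ_cramer_inverse analytic_germ_rotated_UL_map
          analytic_germ_entry) (simp_all add: det)
  qed
  ultimately have diffeo: "real_analytic_diffeomorphism ?F ?S ?T"
    using bij by (simp add: real_analytic_diffeomorphism_def)
  have "?S \<subseteq> dom (Phi (perm_matrix p))"
    using F[OF p] by blast
  with diffeo show ?thesis
    unfolding \<sigma> matrix_inv_perm_matrix[OF p]
    using subgroup_unit_lower_sub[OF p] unit_lower_sub_coordinate_subspace[OF p] by blast
qed

end
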